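(* Let $G$ and $H$ be connected digraphs, and let $x$ be a vertex of $G$ and $y$ a vertex of $H$. If $G\simeq H$ (homotopy equivalent), then $\pi^1_x(G)\cong\pi^1_y(H)$ as Hopf $\mathbb{K}$-algebras.
   Context: $\mathbb{K}$ is a fixed field of characteristic $0$. A digraph $G=(G_0,G_1)$ has a finite vertex set $G_0$ and arrow set $G_1\subset (G_0\times G_0)\setminus\{(v,v)\}$ (no self-loops; both $u\to v$ and $v\to u$ may be arrows). A digraph map $f\colon G\to H$ is a map $G_0\to H_0$ such that for each arrow $u\to v$ of $G$ either $f(u)=f(v)$ or $f(u)\to f(v)$ is an arrow of $H$. A line digraph $I_n$ ($n\ge 0$) has vertices $0,\ldots,n$ and, for each $0\le i<n$, exactly one of the arrows $i\to i+1$, $i+1\to i$, and no other arrows. A path map on $G$ is a digraph map $\alpha\colon I_n\to G$, going from $\alpha(0)$ to $\alpha(n)$; it is a loop at $x$ if $\alpha(0)=\alpha(n)=x$. $G$ is connected if any two vertices are joined by a path map. Homotopy. $G\Box H$ has vertices $G_0\times H_0$ and arrows $(u,u')\to(v,v')$ when either $u=v$ and $u'\to v'\in H_1$, or $u\to v\in G_1$ and $u'=v'$. Digraph maps $f,g\colon G\to H$ are homotopic ($f\simeq g$) if there are a line digraph $I_n$ and a digraph map $F\colon G\Box I_n\to H$ with $F|_{G\Box\{0\}}=f$, $F|_{G\Box\{n\}}=g$. $G\simeq H$ means there are digraph maps $f\colon G\to H$, $g\colon H\to G$ with $f\circ g\simeq\mathrm{Id}_H$ and $g\circ f\simeq\mathrm{Id}_G$.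 A $1$-form on $G$ is a function $\omega\colon G_1\to\mathbb{K}$. For $\alpha\colon I_n\to G$ and $1\le t\le n$, set $\langle\omega,\alpha_t\rangle=0$ if $\alpha(t-1)=\alpha(t)$; otherwise $\langle\omega,\alpha_t\rangle=\omega(\alpha(t-1)\to\alpha(t))$ if $(t-1)\to t$ is in $I_n$, and $\langle\omega,\alpha_t\rangle=-\omega(\alpha(t)\to\alpha(t-1))$ if $t\to (t-1)$ is in $I_n$. With $\tau(t_1,\ldots,t_r)=\prod_{k\ge1}\varphi_k!$, $\varphi_k$ the multiplicity of $k$ in $(t_1,\ldots,t_r)$, define $$\oint_\alpha\omega_1\cdots\omega_r=\sum_{1\le t_1\le\cdots\le t_r\le n}\frac{\prod_{i=1}^r\langle\omega_i,\alpha_{t_i}\rangle}{\tau(t_1,\ldots,t_r)},$$ with the integral of the empty word equal to $1$. $\oint_x\omega_1\cdots\omega_r$ denotes the function $\alpha\mapsto\oint_\alpha\omega_1\cdots\omega_r$ on loops at $x$. $\mathcal{Q}_x(G)$ is the $\mathbb{K}$-algebra of functions on loops at $x$ generated by all $\oint_x\omega_1\cdots\omega_r$, $r\ge1$, with unit the constant function $1$ and pointwise multiplication (which on generators is the shuffle product). It is a Hopf algebra with counit $u\mapsto u(r_x)$ ($r_x$ the constant loop at $x$), comultiplication $\oint_x\omega_1\cdots\omega_r\mapsto\sum_{i=0}^r\oint_x\omega_1\cdots\omega_i\otimes\oint_x\omega_{i+1}\cdots\omega_r$, and antipode $\oint_x\omega_1\cdots\omega_r\mapsto(-1)^r\oint_x\omega_r\cdots\omega_1$.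 $C_\partial$-homotopy. A shrinking map $h\colon I_n\to I_m$ ($m\le n$) is a digraph map with $h(0)=0$, $h(n)=m$, $h(i)\le h(j)$ for $i\le j$. The cylinder $C_h$ has vertex set $(I_n)_0\sqcup(I_m)_0$ and arrows those of $I_n$ and $I_m$ together with $i\to h(i)$ for all $i\in I_n$; $C_h^-$ is the same with $h(i)\to i$ instead. Path maps $\alpha\colon I_n\to G$, $\beta\colon I_m\to G$ with the same initial vertex and the same final vertex are one-step $C_\partial$-homotopic if for some shrinking map $h$ there is a digraph map from $C_h$ or $C_h^-$ to $G$ restricting to $\alpha$ on $I_n$ and $\beta$ on $I_m$. $C_\partial$-homotopy $\simeq_C$ is the equivalence relation generated by this. $\pi^1_x(G)$ is the subalgebra of $\mathcal{Q}_x(G)$ consisting of all elements $u$ with $u(\alpha)=u(\alpha')$ for all loops $\alpha\simeq_C\alpha'$ at $x$; it is a Hopf subalgebra of $\mathcal{Q}_x(G)$. *)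

theory Defs
  imports
    "Graph_Theory.Pair_Digraph"
    "HOL-Algebra.Module"
    "HOL-Algebra.QuotRing"
    "HOL-Library.Poly_Mapping"
begin

section \<open>Digraphs, path maps and homotopy\<close>

text \<open>
  A digraph is a \<open>pair_pre_digraph\<close> satisfying \<open>pair_digraph\<close>: finitely many vertices, arrows
  are ordered pairs of distinct vertices.
\<close>

definition digraph_map :: "'a pair_pre_digraph \<Rightarrow> 'b pair_pre_digraph \<Rightarrow> ('a \<Rightarrow> 'b) \<Rightarrow> bool" where
  "digraph_map G H f \<longleftrightarrow> f \<in> pverts G \<rightarrow> pverts H \<and>
     (\<forall>(u, v) \<in> parcs G. f u = f v \<or> (f u, f v) \<in> parcs H)"

definition line_digraph :: "nat \<Rightarrow> nat pair_pre_digraph \<Rightarrow> bool" where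
  "line_digraph n I \<longleftrightarrow> pverts I = {0..n} \<and>
     parcs I \<subseteq> (\<Union>i<n. {(i, Suc i), (Suc i, i)}) \<and>
     (\<forall>i<n. ((i, Suc i) \<in> parcs I) \<noteq> ((Suc i, i) \<in> parcs I))"

record 'a path_map =
  plen :: nat
  pline :: "nat pair_pre_digraph"
  pmap :: "nat \<Rightarrow> 'a"

text \<open>
  The underlying function is required to be extensional so that equality of records is equality
  of path maps.
\<close>

definition path_map :: "'a pair_pre_digraph \<Rightarrow> 'a path_map \<Rightarrow> bool" where
  "path_map G \<alpha> \<longleftrightarrow> line_digraph (plen \<alpha>) (pline \<alpha>) \<and> digraph_map (pline \<alpha>) G (pmap \<alpha>) \<and>
     pmap \<alpha> \<in> extensional {0..plen \<alpha>}"

definition pstart :: "'a path_map \<Rightarrow> 'a" where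
  "pstart \<alpha> = pmap \<alpha> 0"

definition pend :: "'a path_map \<Rightarrow> 'a" where
  "pend \<alpha> = pmap \<alpha> (plen \<alpha>)"

definition loops :: "'a pair_pre_digraph \<Rightarrow> 'a \<Rightarrow> 'a path_map set" where
  "loops G x = {\<alpha>. path_map G \<alpha> \<and> pstart \<alpha> = x \<and> pend \<alpha> = x}"

definition const_loop :: "'a \<Rightarrow> 'a path_map" where
  "const_loop x = \<lparr>plen = 0, pline = \<lparr>pverts = {0}, parcs = {}\<rparr>, pmap = (\<lambda>i \<in> {0..0}. x)\<rparr>"

definition connected_digraph :: "'a pair_pre_digraph \<Rightarrow> bool" where
  "connected_digraph G \<longleftrightarrow>
     (\<forall>u \<in> pverts G. \<forall>v \<in> pverts G. \<exists>\<alpha>. path_map G \<alpha> \<and> pstart \<alpha> = u \<and> pend \<alpha> = v)"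

definition box_product ::
    "'a pair_pre_digraph \<Rightarrow> 'b pair_pre_digraph \<Rightarrow> ('a \<times> 'b) pair_pre_digraph" where
  "box_product G H = \<lparr>pverts = pverts G \<times> pverts H,
     parcs = {((u, u'), (v, v')) | u u' v v'.
       (u \<in> pverts G \<and> u = v \<and> (u', v') \<in> parcs H) \<or>
       ((u, v) \<in> parcs G \<and> u' \<in> pverts H \<and> u' = v')}\<rparr>"

definition homotopic_maps ::
    "'a pair_pre_digraph \<Rightarrow> 'b pair_pre_digraph \<Rightarrow> ('a \<Rightarrow> 'b) \<Rightarrow> ('a \<Rightarrow> 'b) \<Rightarrow> bool" where
  "homotopic_maps G H f g \<longleftrightarrow>
     (\<exists>n I F. line_digraph n I \<and> digraph_map (box_product G I) H F \<and>
       (\<forall>v \<in> pverts G. F (v, 0) = f v \<and> F (v, n) = g v))"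

definition homotopy_equivalent :: "'a pair_pre_digraph \<Rightarrow> 'b pair_pre_digraph \<Rightarrow> bool" where
  "homotopy_equivalent G H \<longleftrightarrow>
     (\<exists>f g. digraph_map G H f \<and> digraph_map H G g \<and>
       homotopic_maps H H (f \<circ> g) id \<and> homotopic_maps G G (g \<circ> f) id)"


section \<open>\<open>C\<^sub>\<partial>\<close>-homotopy\<close>

definition shrinking_map ::
    "nat \<Rightarrow> nat pair_pre_digraph \<Rightarrow> nat \<Rightarrow> nat pair_pre_digraph \<Rightarrow> (nat \<Rightarrow> nat) \<Rightarrow> bool" where
  "shrinking_map n I m J h \<longleftrightarrow> m \<le> n \<and> digraph_map I J h \<and> h 0 = 0 \<and> h n = m \<and>
     mono_on {0..n} h"

definition cylinder ::
    "nat pair_pre_digraph \<Rightarrow> nat pair_pre_digraph \<Rightarrow> (nat \<Rightarrow> nat) \<Rightarrow> (nat + nat) pair_pre_digraph"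
  where
  "cylinder I J h = \<lparr>pverts = pverts I <+> pverts J,
     parcs = map_prod Inl Inl ` parcs I \<union> map_prod Inr Inr ` parcs J \<union>
       {(Inl i, Inr (h i)) | i. i \<in> pverts I}\<rparr>"

definition cylinder_minus ::
    "nat pair_pre_digraph \<Rightarrow> nat pair_pre_digraph \<Rightarrow> (nat \<Rightarrow> nat) \<Rightarrow> (nat + nat) pair_pre_digraph"
  where
  "cylinder_minus I J h = \<lparr>pverts = pverts I <+> pverts J,
     parcs = map_prod Inl Inl ` parcs I \<union> map_prod Inr Inr ` parcs J \<union>
       {(Inr (h i), Inl i) | i. i \<in> pverts I}\<rparr>"

definition one_step_C_homotopic ::
    "'a pair_pre_digraph \<Rightarrow> 'a path_map \<Rightarrow> 'a path_map \<Rightarrow> bool" where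
  "one_step_C_homotopic G \<alpha> \<beta> \<longleftrightarrow>
     path_map G \<alpha> \<and> path_map G \<beta> \<and> pstart \<alpha> = pstart \<beta> \<and> pend \<alpha> = pend \<beta> \<and>
     (\<exists>h F. shrinking_map (plen \<alpha>) (pline \<alpha>) (plen \<beta>) (pline \<beta>) h \<and>
       (digraph_map (cylinder (pline \<alpha>) (pline \<beta>) h) G F \<or>
        digraph_map (cylinder_minus (pline \<alpha>) (pline \<beta>) h) G F) \<and>
       (\<forall>i \<in> {0..plen \<alpha>}. F (Inl i) = pmap \<alpha> i) \<and>
       (\<forall>j \<in> {0..plen \<beta>}. F (Inr j) = pmap \<beta> j))"

definition C_homotopic :: "'a pair_pre_digraph \<Rightarrow> 'a path_map \<Rightarrow> 'a path_map \<Rightarrow> bool" where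
  "C_homotopic G = equivclp (one_step_C_homotopic G)"


section \<open>Iterated integrals\<close>

text \<open>
  The ground field is a type \<open>'k\<close> of class \<open>field_char_0\<close>; a 1-form is a function on the arrows,
  extended by \<open>undefined\<close> to all pairs.
\<close>

definition one_forms :: "'a pair_pre_digraph \<Rightarrow> ('a \<times> 'a \<Rightarrow> 'k) set" where
  "one_forms G = extensional (parcs G)"

definition form_at :: "('a \<times> 'a \<Rightarrow> 'k::field_char_0) \<Rightarrow> 'a path_map \<Rightarrow> nat \<Rightarrow> 'k" where
  "form_at \<omega> \<alpha> t =
     (if pmap \<alpha> (t - 1) = pmap \<alpha> t then 0
      else if (t - 1, t) \<in> parcs (pline \<alpha>) then \<omega> (pmap \<alpha> (t - 1), pmap \<alpha> t)
      else - \<omega> (pmap \<alpha> t, pmap \<alpha> (t - 1)))"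

definition mult_fact :: "nat list \<Rightarrow> nat" where
  "mult_fact ts = (\<Prod>k \<in> set ts. fact (count_list ts k))"

definition iter_integral :: "('a \<times> 'a \<Rightarrow> 'k::field_char_0) list \<Rightarrow> 'a path_map \<Rightarrow> 'k" where
  "iter_integral ws \<alpha> =
     (\<Sum>ts | length ts = length ws \<and> set ts \<subseteq> {1..plen \<alpha>} \<and> sorted ts.
        (\<Prod>i<length ws. form_at (ws ! i) \<alpha> (ts ! i)) / of_nat (mult_fact ts))"

text \<open>Functions on the loops at \<open>x\<close> are represented as extensional functions.\<close>

definition loop_integral ::
    "'a pair_pre_digraph \<Rightarrow> 'a \<Rightarrow> ('a \<times> 'a \<Rightarrow> 'k::field_char_0) list \<Rightarrow> ('a path_map \<Rightarrow> 'k)" where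
  "loop_integral G x ws = (\<lambda>\<alpha> \<in> loops G x. iter_integral ws \<alpha>)"


section \<open>Tensor squares and Hopf algebra isomorphisms\<close>

text \<open>
  For a vector space \<open>A\<close> over \<open>'k\<close> with carrier set, \<open>A \<otimes> A\<close> is the quotient of the free vector
  space on \<open>carrier A \<times> carrier A\<close> (finitely supported functions) by the subspace
  \<open>tensor_null A\<close> spanned by the bilinearity relations. Its elements are cosets, that is, sets of
  finitely supported functions.
\<close>

inductive_set tensor_null :: "('k::field, 'u, 'm) module_scheme \<Rightarrow> ('u \<times> 'u \<Rightarrow>\<^sub>0 'k) set"
  for A :: "('k, 'u, 'm) module_scheme" where
  zero: "0 \<in> tensor_null A"
| plus: "s \<in> tensor_null A \<Longrightarrow> t \<in> tensor_null A \<Longrightarrow> s + t \<in> tensor_null A"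
| scale: "t \<in> tensor_null A \<Longrightarrow> Poly_Mapping.map ((*) c) t \<in> tensor_null A"
| add_left: "u \<in> carrier A \<Longrightarrow> u' \<in> carrier A \<Longrightarrow> v \<in> carrier A \<Longrightarrow>
    Poly_Mapping.single (u \<oplus>\<^bsub>A\<^esub> u', v) 1 - Poly_Mapping.single (u, v) 1
      - Poly_Mapping.single (u', v) 1 \<in> tensor_null A"
| add_right: "u \<in> carrier A \<Longrightarrow> v \<in> carrier A \<Longrightarrow> v' \<in> carrier A \<Longrightarrow>
    Poly_Mapping.single (u, v \<oplus>\<^bsub>A\<^esub> v') 1 - Poly_Mapping.single (u, v) 1
      - Poly_Mapping.single (u, v') 1 \<in> tensor_null A"
| smult_left: "u \<in> carrier A \<Longrightarrow> v \<in> carrier A \<Longrightarrow>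
    Poly_Mapping.single (c \<odot>\<^bsub>A\<^esub> u, v) 1 - Poly_Mapping.single (u, v) c \<in> tensor_null A"
| smult_right: "u \<in> carrier A \<Longrightarrow> v \<in> carrier A \<Longrightarrow>
    Poly_Mapping.single (u, c \<odot>\<^bsub>A\<^esub> v) 1 - Poly_Mapping.single (u, v) c \<in> tensor_null A"

definition tensor_class ::
    "('k::field, 'u, 'm) module_scheme \<Rightarrow> ('u \<times> 'u \<Rightarrow>\<^sub>0 'k) \<Rightarrow> ('u \<times> 'u \<Rightarrow>\<^sub>0 'k) set" where
  "tensor_class A t =
     {s. Poly_Mapping.keys s \<subseteq> carrier A \<times> carrier A \<and> s - t \<in> tensor_null A}"

text \<open>\<open>\<phi> \<otimes> \<phi>\<close>, as a map from cosets to cosets of \<open>tensor_null B\<close>.\<close>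

definition tensor_map ::
    "('k::field, 'v, 'm) module_scheme \<Rightarrow> ('u \<Rightarrow> 'v) \<Rightarrow> ('u \<times> 'u \<Rightarrow>\<^sub>0 'k) set
       \<Rightarrow> ('v \<times> 'v \<Rightarrow>\<^sub>0 'k) set" where
  "tensor_map B \<phi> X = (\<Union>t \<in> X. tensor_class B
     (\<Sum>(u, v) \<in> Poly_Mapping.keys t.
        Poly_Mapping.single (\<phi> u, \<phi> v) (Poly_Mapping.lookup t (u, v))))"

record (overloaded) ('k::zero, 'u) hopf_algebra = "('k, 'u) module" +
  counit :: "'u \<Rightarrow> 'k"
  comult :: "'u \<Rightarrow> ('u \<times> 'u \<Rightarrow>\<^sub>0 'k) set"
  antipode :: "'u \<Rightarrow> 'u"

definition hopf_iso ::
    "('k::field, 'u) hopf_algebra \<Rightarrow> ('k, 'v) hopf_algebra \<Rightarrow> ('u \<Rightarrow> 'v) set" where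
  "hopf_iso A B = {\<phi> \<in> ring_iso A B.
     (\<forall>c. \<forall>u \<in> carrier A. \<phi> (c \<odot>\<^bsub>A\<^esub> u) = c \<odot>\<^bsub>B\<^esub> \<phi> u) \<and>
     (\<forall>u \<in> carrier A. counit B (\<phi> u) = counit A u) \<and>
     (\<forall>u \<in> carrier A. comult B (\<phi> u) = tensor_map B \<phi> (comult A u)) \<and>
     (\<forall>u \<in> carrier A. antipode B (\<phi> u) = \<phi> (antipode A u))}"

definition hopf_isomorphic :: "('k::field, 'u) hopf_algebra \<Rightarrow> ('k, 'v) hopf_algebra \<Rightarrow> bool" where
  "hopf_isomorphic A B \<longleftrightarrow> hopf_iso A B \<noteq> {}"

text \<open>
  The Hopf subalgebra with carrier \<open>S\<close>. Over a field \<open>S \<otimes> S \<rightarrow> A \<otimes> A\<close> is injective, and the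
  comultiplication of \<open>u\<close> in \<open>S\<close> is the preimage under this map of its comultiplication in \<open>A\<close>.
\<close>

definition hopf_sub :: "('k::field, 'u) hopf_algebra \<Rightarrow> 'u set \<Rightarrow> ('k, 'u) hopf_algebra" where
  "hopf_sub A S = A\<lparr>carrier := S,
     comult := (\<lambda>u. {t \<in> comult A u. Poly_Mapping.keys t \<subseteq> S \<times> S})\<rparr>"


section \<open>The Hopf algebras \<open>Q\<^sub>x(G)\<close> and \<open>\<pi>\<^sup>1\<^sub>x(G)\<close>\<close>

inductive_set Q_carrier :: "'a pair_pre_digraph \<Rightarrow> 'a \<Rightarrow> ('a path_map \<Rightarrow> 'k::field_char_0) set"
  for G :: "'a pair_pre_digraph" and x :: 'a where
  one: "(\<lambda>\<alpha> \<in> loops G x. 1) \<in> Q_carrier G x"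
| gen: "ws \<in> lists (one_forms G) \<Longrightarrow> ws \<noteq> [] \<Longrightarrow> loop_integral G x ws \<in> Q_carrier G x"
| add: "u \<in> Q_carrier G x \<Longrightarrow> v \<in> Q_carrier G x \<Longrightarrow>
    (\<lambda>\<alpha> \<in> loops G x. u \<alpha> + v \<alpha>) \<in> Q_carrier G x"
| mult: "u \<in> Q_carrier G x \<Longrightarrow> v \<in> Q_carrier G x \<Longrightarrow>
    (\<lambda>\<alpha> \<in> loops G x. u \<alpha> * v \<alpha>) \<in> Q_carrier G x"
| smult: "u \<in> Q_carrier G x \<Longrightarrow> (\<lambda>\<alpha> \<in> loops G x. c * u \<alpha>) \<in> Q_carrier G x"

definition Q_algebra ::
    "'a pair_pre_digraph \<Rightarrow> 'a \<Rightarrow> ('k::field_char_0, 'a path_map \<Rightarrow> 'k) module" where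
  "Q_algebra G x = \<lparr>carrier = Q_carrier G x,
     monoid.mult = (\<lambda>u v. \<lambda>\<alpha> \<in> loops G x. u \<alpha> * v \<alpha>),
     one = (\<lambda>\<alpha> \<in> loops G x. 1),
     zero = (\<lambda>\<alpha> \<in> loops G x. 0),
     add = (\<lambda>u v. \<lambda>\<alpha> \<in> loops G x. u \<alpha> + v \<alpha>),
     smult = (\<lambda>c u. \<lambda>\<alpha> \<in> loops G x. c * u \<alpha>)\<rparr>"

text \<open>
  Since products of iterated integrals are given by shuffles, every element of \<open>Q\<^sub>x(G)\<close> is a linear
  combination of iterated integrals, the empty word included. The comultiplication and the antipode
  are the linear maps prescribed on iterated integrals, i.e. the maps induced on \<open>Q\<^sub>x(G)\<close> by the
  maps \<open>word_comult\<close> and \<open>word_antipode\<close> on formal linear combinations \<open>c\<close> of words of 1-forms.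
\<close>

definition word_combs ::
    "'a pair_pre_digraph \<Rightarrow> (('a \<times> 'a \<Rightarrow> 'k) list \<Rightarrow>\<^sub>0 'k::field_char_0) set" where
  "word_combs G = {c. Poly_Mapping.keys c \<subseteq> lists (one_forms G)}"

definition word_value :: "'a pair_pre_digraph \<Rightarrow> 'a \<Rightarrow>
    (('a \<times> 'a \<Rightarrow> 'k) list \<Rightarrow>\<^sub>0 'k::field_char_0) \<Rightarrow> ('a path_map \<Rightarrow> 'k)" where
  "word_value G x c = (\<lambda>\<alpha> \<in> loops G x.
     \<Sum>ws \<in> Poly_Mapping.keys c. Poly_Mapping.lookup c ws * loop_integral G x ws \<alpha>)"

definition word_comult :: "'a pair_pre_digraph \<Rightarrow> 'a \<Rightarrow>
    (('a \<times> 'a \<Rightarrow> 'k) list \<Rightarrow>\<^sub>0 'k::field_char_0) \<Rightarrow>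
    (('a path_map \<Rightarrow> 'k) \<times> ('a path_map \<Rightarrow> 'k) \<Rightarrow>\<^sub>0 'k)" where
  "word_comult G x c = (\<Sum>ws \<in> Poly_Mapping.keys c. \<Sum>i\<le>length ws.
     Poly_Mapping.single (loop_integral G x (take i ws), loop_integral G x (drop i ws))
       (Poly_Mapping.lookup c ws))"

definition word_antipode :: "'a pair_pre_digraph \<Rightarrow> 'a \<Rightarrow>
    (('a \<times> 'a \<Rightarrow> 'k) list \<Rightarrow>\<^sub>0 'k::field_char_0) \<Rightarrow> ('a path_map \<Rightarrow> 'k)" where
  "word_antipode G x c = (\<lambda>\<alpha> \<in> loops G x. \<Sum>ws \<in> Poly_Mapping.keys c.
     Poly_Mapping.lookup c ws * ((-1) ^ length ws * loop_integral G x (rev ws) \<alpha>))"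

definition Q_counit :: "'a \<Rightarrow> ('a path_map \<Rightarrow> 'k) \<Rightarrow> 'k" where
  "Q_counit x u = u (const_loop x)"

definition Q_comult :: "'a pair_pre_digraph \<Rightarrow> 'a \<Rightarrow> ('a path_map \<Rightarrow> 'k::field_char_0) \<Rightarrow>
    (('a path_map \<Rightarrow> 'k) \<times> ('a path_map \<Rightarrow> 'k) \<Rightarrow>\<^sub>0 'k) set" where
  "Q_comult G x u =
     (\<Union>c \<in> {c \<in> word_combs G. word_value G x c = u}.
        tensor_class (Q_algebra G x) (word_comult G x c))"

definition Q_antipode :: "'a pair_pre_digraph \<Rightarrow> 'a \<Rightarrow> ('a path_map \<Rightarrow> 'k::field_char_0) \<Rightarrow>
    ('a path_map \<Rightarrow> 'k)" where
  "Q_antipode G x u =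
     (THE v. \<exists>c \<in> word_combs G. word_value G x c = u \<and> word_antipode G x c = v)"

definition Q_hopf ::
    "'a pair_pre_digraph \<Rightarrow> 'a \<Rightarrow> ('k::field_char_0, 'a path_map \<Rightarrow> 'k) hopf_algebra" where
  "Q_hopf G x = module.extend (Q_algebra G x)
     \<lparr>counit = Q_counit x, comult = Q_comult G x, antipode = Q_antipode G x\<rparr>"

definition pi1_carrier :: "'a pair_pre_digraph \<Rightarrow> 'a \<Rightarrow> ('a path_map \<Rightarrow> 'k::field_char_0) set" where
  "pi1_carrier G x = {u \<in> Q_carrier G x.
     \<forall>\<alpha> \<in> loops G x. \<forall>\<alpha>' \<in> loops G x. C_homotopic G \<alpha> \<alpha>' \<longrightarrow> u \<alpha> = u \<alpha>'}"

definition pi1_hopf ::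
    "'a pair_pre_digraph \<Rightarrow> 'a \<Rightarrow> ('k::field_char_0, 'a path_map \<Rightarrow> 'k) hopf_algebra" where
  "pi1_hopf G x = hopf_sub (Q_hopf G x) (pi1_carrier G x)"

end

theory Submission
  imports Defs
begin

text \<open>
  The isomorphism is pullback of functions along an operation on loops. Let \<open>f\<close> and \<open>g\<close> be mutually
  inverse homotopy equivalences between \<open>G\<close> and \<open>H\<close>, and let \<open>c\<close> be a walk in \<open>G\<close> from \<open>g y\<close> to \<open>x\<close>. A
  loop at \<open>y\<close> is sent by \<open>g\<close> to a loop at \<open>g y\<close> and then conjugated by \<open>c\<close>; this is \<open>transport\<close>. It
  preserves homotopy of loops, and up to homotopy it respects concatenation and the constant loop; it
  commutes with reversal. Pulling back an iterated integral yields a linear combination of iterated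
  integrals of pulled back forms (\<open>pull_Q\<close>), so functions in \<open>\<pi>\<^sup>1\<^sub>x(G)\<close> pull back to functions in
  \<open>\<pi>\<^sup>1\<^sub>y(H)\<close>.

  The whole Hopf structure can be read off from values on loops. Sums and products are pointwise. The
  comultiplication of \<open>u\<close> consists of the tensors that represent the function sending a pair of loops
  to the value of \<open>u\<close> at their concatenation (\<open>Q_comult_eq\<close>), and the antipode is composition with
  reversal (\<open>Q_antipode_walk\<close>). Three facts are behind this: Chen's formulas for concatenation and
  reversal, the shuffle formula, by which every element is a combination of words
  (\<open>Q_carrier_word_value\<close>), and the injectivity of the map from the tensor square of a function space to
  functions of two variables (\<open>null_iff_pairing\<close>). The formulas for iterated integrals are identities
  between formal series: the iterated integrals of a path form the ordered product of the exponential
  series of its steps (\<open>chen_eq_sum_index_seqs\<close>), and products of exponentials are group-like.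

  Transport is bijective on homotopy classes of loops. A homotopy from \<open>f \<circ> g\<close> to the identity moves
  the base point along a walk \<open>p\<close>, and every loop and its image under \<open>f \<circ> g\<close> differ by conjugation with
  \<open>p\<close> (\<open>homotopic_maps_track\<close>). With the walk \<open>d\<close> that first runs back along the image of \<open>c\<close> and then
  along \<open>p\<close>, transport by \<open>f\<close> and \<open>d\<close> undoes transport by \<open>g\<close> and \<open>c\<close> up to homotopy. In the other order
  the composite is conjugation by a loop, so transport by \<open>g\<close> and \<open>c\<close> reaches every homotopy class.

  Path maps are handled as lists of steps, and the digraph maps on cylinders that define
  \<open>C\<^sub>\<partial>\<close>-homotopy as an inductive relation \<open>prism\<close> between such lists, for which extension by further
  steps, cancellation of backtracking and the strips swept out by a homotopy are inductions.
\<close>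

section \<open>Iterated integrals as products of exponentials\<close>

text \<open>
  A function on words over an alphabet is a noncommutative formal power series in the letters, and
  \<open>conv\<close> is the product of such series. The iterated integrals of a path, as a function of the word
  of forms, make up such a series (Chen's generating series); everything that the Hopf structure
  needs from them is an identity between series.
\<close>

definition conv :: "('w list \<Rightarrow> 'k::field_char_0) \<Rightarrow> ('w list \<Rightarrow> 'k) \<Rightarrow> 'w list \<Rightarrow> 'k"
    (infixl "\<star>" 70) where
  "(f \<star> g) ws = (\<Sum>i\<le>length ws. f (take i ws) * g (drop i ws))"

definition empty_word :: "'w list \<Rightarrow> 'k::field_char_0" where
  "empty_word ws = (if ws = [] then 1 else 0)"

text \<open>
  The exponential series of the linear form \<open>\<Sum>w. e w \<cdot> w\<close>. A single step of a path contributes such a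
  factor: the words whose indices all meet this step are weighted by one over the factorial of their
  length, and that weight is the multiplicity factor of the discrete iterated integral.
\<close>

definition exp_word :: "('w \<Rightarrow> 'k::field_char_0) \<Rightarrow> 'w list \<Rightarrow> 'k" where
  "exp_word e ws = prod_list (map e ws) / fact (length ws)"

primrec chen :: "('w \<Rightarrow> 'k::field_char_0) list \<Rightarrow> 'w list \<Rightarrow> 'k" where
  "chen [] = empty_word"
| "chen (e # es) = exp_word e \<star> chen es"

lemma conv_Nil: "(f \<star> g) [] = f [] * g []"
  by (simp add: conv_def)

text \<open>
  Peeling off the first letter turns identities between products into inductions on the word in
  which the left factor varies.
\<close>

lemma conv_Cons: "(f \<star> g) (w # ws) = f [] * g (w # ws) + ((\<lambda>v. f (w # v)) \<star> g) ws"
  by (simp add: conv_def sum.atMost_Suc_shift del: sum.atMost_Suc)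

lemma conv_scale_add_left:
  "((\<lambda>v. c * f v + f' v) \<star> g) ws = c * (f \<star> g) ws + (f' \<star> g) ws"
  by (simp add: conv_def sum.distrib sum_distrib_left algebra_simps)

lemma conv_assoc: "(f \<star> g) \<star> h = f \<star> (g \<star> h)"
proof
  fix ws show "((f \<star> g) \<star> h) ws = (f \<star> (g \<star> h)) ws"
  proof (induction ws arbitrary: f)
    case Nil
    show ?case by (simp add: conv_Nil)
  next
    case (Cons w ws)
    show ?case
      by (simp add: conv_Cons conv_Nil conv_scale_add_left Cons.IH algebra_simps)
  qed
qed

lemma empty_word_conv: "empty_word \<star> f = f"
proof
  fix ws :: "'a list"
  have "(empty_word \<star> f) ws = (\<Sum>i\<in>{0}. empty_word (take i ws) * f (drop i ws))"
    unfolding conv_def by (rule sum.mono_neutral_right) (auto simp: empty_word_def)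
  then show "(empty_word \<star> f) ws = f ws" by (simp add: empty_word_def)
qed

lemma conv_empty_word: "f \<star> empty_word = f"
proof
  fix ws :: "'a list"
  have "(f \<star> empty_word) ws = (\<Sum>i\<in>{length ws}. f (take i ws) * empty_word (drop i ws))"
    unfolding conv_def by (rule sum.mono_neutral_right) (auto simp: empty_word_def)
  then show "(f \<star> empty_word) ws = f ws" by (simp add: empty_word_def)
qed

lemma chen_append: "chen (es @ fs) = chen es \<star> chen fs"
  by (induction es) (simp_all add: empty_word_conv conv_assoc)

lemma chen_Nil_word: "chen es [] = 1"
  by (induction es) (simp_all add: conv_Nil empty_word_def exp_word_def)

lemma chen_map_word: "chen es (map p ws) = chen (map (\<lambda>e. e \<circ> p) es) ws"
proof (induction es arbitrary: ws)
  case Nil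
  show ?case by (simp add: empty_word_def)
next
  case (Cons e es)
  then show ?case
    by (simp add: conv_def exp_word_def take_map drop_map o_def)
qed

text \<open>
  The transpose of the antipode of the shuffle algebra. It is an anti-automorphism and inverts
  exponentials, hence it inverts every product of exponentials; for paths this is inversion of the
  path.
\<close>

definition word_flip :: "('w list \<Rightarrow> 'k::field_char_0) \<Rightarrow> 'w list \<Rightarrow> 'k" where
  "word_flip f ws = (- 1) ^ length ws * f (rev ws)"

lemma word_flip_conv: "word_flip (f \<star> g) = word_flip g \<star> word_flip f"
proof
  fix ws :: "'a list"
  let ?n = "length ws"
  have "word_flip (f \<star> g) ws =
      (\<Sum>i\<le>?n. (- 1) ^ ?n * (f (take i (rev ws)) * g (drop i (rev ws))))"
    by (simp add: word_flip_def conv_def sum_distrib_left)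
  also have "\<dots> = (\<Sum>i\<le>?n. (- 1) ^ ?n * (f (take (?n - i) (rev ws)) * g (drop (?n - i) (rev ws))))"
    by (rule sum.reindex_bij_witness[of _ "\<lambda>i. ?n - i" "\<lambda>i. ?n - i"]) auto
  also have "\<dots> = (word_flip g \<star> word_flip f) ws"
    unfolding conv_def
  proof (rule sum.cong)
    fix i assume "i \<in> {..?n}"
    then have i: "i \<le> ?n" by simp
    have "(- 1 :: 'b) ^ ?n = (- 1) ^ i * (- 1) ^ (?n - i)"
      using i by (simp flip: power_add)
    then show "(- 1) ^ ?n * (f (take (?n - i) (rev ws)) * g (drop (?n - i) (rev ws))) =
        word_flip g (take i ws) * word_flip f (drop i ws)"
      using i by (simp add: word_flip_def rev_take rev_drop min_def)
  qed simp
  finally show "word_flip (f \<star> g) ws = (word_flip g \<star> word_flip f) ws" .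
qed

lemma exp_word_uminus: "exp_word (\<lambda>w. - e w) = word_flip (exp_word e)"
proof
  fix ws
  have "prod_list (map (\<lambda>w. - e w) ws) = (- 1) ^ length ws * prod_list (map e ws)"
    by (induction ws) simp_all
  then show "exp_word (\<lambda>w. - e w) ws = word_flip (exp_word e) ws"
    by (simp add: exp_word_def word_flip_def rev_map[symmetric] prod_list.rev)
qed

lemma chen_rev_uminus: "chen (rev (map (\<lambda>e w. - e w) es)) = word_flip (chen es)"
proof (induction es)
  case Nil
  show ?case by (auto simp: word_flip_def empty_word_def)
next
  case (Cons e es)
  then show ?case
    by (simp add: chen_append conv_empty_word word_flip_conv exp_word_uminus)
qed

text \<open>
  Shuffles are kept in a list and not in a set, because the shuffle product counts a word as often as
  it arises.
\<close>

fun shuffle_list :: "'w list \<Rightarrow> 'w list \<Rightarrow> 'w list list" where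
  "shuffle_list [] vs = [vs]"
| "shuffle_list (w # ws) [] = [w # ws]"
| "shuffle_list (w # ws) (v # vs) =
     map ((#) w) (shuffle_list ws (v # vs)) @ map ((#) v) (shuffle_list (w # ws) vs)"

lemma shuffle_list_Nil2 [simp]: "shuffle_list ws [] = [ws]"
  by (cases ws) auto

lemma length_shuffle_list:
  "length (shuffle_list ws vs) = (length ws + length vs) choose length ws"
  by (induction ws vs rule: shuffle_list.induct) simp_all

lemma set_shuffle_list:
  "z \<in> set (shuffle_list ws vs) \<Longrightarrow> set z = set ws \<union> set vs"
  by (induction ws vs arbitrary: z rule: shuffle_list.induct) auto

lemma exp_word_shuffle_list:
  "z \<in> set (shuffle_list ws vs) \<Longrightarrow>
    exp_word e z = prod_list (map e ws) * prod_list (map e vs) / fact (length ws + length vs)"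
proof -
  assume z: "z \<in> set (shuffle_list ws vs)"
  have "length z = length ws + length vs \<and>
      prod_list (map e z) = prod_list (map e ws) * prod_list (map e vs)"
    using z by (induction ws vs arbitrary: z rule: shuffle_list.induct) auto
  then show ?thesis by (simp add: exp_word_def)
qed

text \<open>
  Multiplicativity for the shuffle product; for power series this is being group-like.
\<close>

definition character :: "('w list \<Rightarrow> 'k::field_char_0) \<Rightarrow> bool" where
  "character f \<longleftrightarrow> (\<forall>ws vs. f ws * f vs = sum_list (map f (shuffle_list ws vs)))"

text \<open>
  All shuffles of two words have the same letters, so \<open>exp_word\<close> takes one and the same value on
  them, and their number is the binomial coefficient relating the three factorials.
\<close>

lemma character_exp_word: "character (exp_word e)"
  unfolding character_def
proof (intro allI)
  fix ws vs :: "'a list"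
  let ?p = "prod_list (map e ws) * prod_list (map e vs)"
  have "sum_list (map (exp_word e) (shuffle_list ws vs)) =
      sum_list (map (\<lambda>_. ?p / fact (length ws + length vs)) (shuffle_list ws vs))"
    by (rule arg_cong[where f = sum_list], rule map_cong) (simp_all add: exp_word_shuffle_list)
  also have "\<dots> = of_nat ((length ws + length vs) choose length ws) *
      (?p / fact (length ws + length vs))"
    by (simp add: sum_list_triv length_shuffle_list)
  also have "\<dots> = exp_word e ws * exp_word e vs"
    by (simp add: binomial_fact exp_word_def)
  finally show "exp_word e ws * exp_word e vs = sum_list (map (exp_word e) (shuffle_list ws vs))"
    by simp
qed

text \<open>
  Deconcatenation is multiplicative for the shuffle product: cutting a shuffle of two words in two
  amounts to cutting both words and shuffling the left parts and the right parts separately.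
\<close>

lemma sum_conv_shuffle_list:
  fixes F :: "'w list \<Rightarrow> 'w list \<Rightarrow> 'k::field_char_0"
  shows "(\<Sum>z\<leftarrow>shuffle_list ws vs. \<Sum>k\<le>length z. F (take k z) (drop k z)) =
    (\<Sum>i\<le>length ws. \<Sum>j\<le>length vs. \<Sum>a\<leftarrow>shuffle_list (take i ws) (take j vs).
        \<Sum>b\<leftarrow>shuffle_list (drop i ws) (drop j vs). F a b)"
proof (induction ws vs arbitrary: F rule: shuffle_list.induct)
  case (1 vs)
  show ?case by simp
next
  case (2 w ws)
  show ?case by simp
next
  case (3 w ws v vs)
  let ?D = "\<lambda>z. \<Sum>k\<le>length z. F (take k z) (drop k z)"
  have D: "?D (x # z) = F [] (x # z) + (\<Sum>k\<le>length z. F (x # take k z) (drop k z))" for x z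
    by (simp add: sum.atMost_Suc_shift del: sum.atMost_Suc)
  let ?S = "shuffle_list (w # ws) (v # vs)"
  let ?W = "\<lambda>i j. \<Sum>a\<leftarrow>shuffle_list (take i ws) (take j (v # vs)).
     \<Sum>b\<leftarrow>shuffle_list (drop i ws) (drop j (v # vs)). F (w # a) b"
  let ?V = "\<lambda>i j. \<Sum>a\<leftarrow>shuffle_list (take i (w # ws)) (take j vs).
     \<Sum>b\<leftarrow>shuffle_list (drop i (w # ws)) (drop j vs). F (v # a) b"
  let ?R = "\<lambda>i j. \<Sum>a\<leftarrow>shuffle_list (take i (w # ws)) (take j (v # vs)).
     \<Sum>b\<leftarrow>shuffle_list (drop i (w # ws)) (drop j (v # vs)). F a b"
  \<comment> \<open>The terms are sorted by the first letter of the left part: it is missing, it is \<open>w\<close>, or it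
      is \<open>v\<close>.\<close>
  have "(\<Sum>z\<leftarrow>?S. ?D z) = (\<Sum>z\<leftarrow>?S. F [] z) +
      (\<Sum>z\<leftarrow>shuffle_list ws (v # vs). \<Sum>k\<le>length z. F (w # take k z) (drop k z)) +
      (\<Sum>z\<leftarrow>shuffle_list (w # ws) vs. \<Sum>k\<le>length z. F (v # take k z) (drop k z))"
    by (simp only: shuffle_list.simps map_append map_map o_def D sum_list.append sum_list_addf)
      (simp add: algebra_simps)
  also have "\<dots> = (\<Sum>z\<leftarrow>?S. F [] z) + (\<Sum>i\<le>length ws. \<Sum>j\<le>Suc (length vs). ?W i j) +
      (\<Sum>i\<le>Suc (length ws). \<Sum>j\<le>length vs. ?V i j)"
    using "3.IH"(1)[of "\<lambda>a b. F (w # a) b"] "3.IH"(2)[of "\<lambda>a b. F (v # a) b"]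
    by (simp del: sum.atMost_Suc)
  also have "\<dots> = (\<Sum>i\<le>Suc (length ws). \<Sum>j\<le>Suc (length vs). ?R i j)"
    by (simp add: sum.atMost_Suc_shift sum.distrib sum_list_addf o_def del: sum.atMost_Suc)
  finally show ?case by simp
qed

lemma character_conv:
  assumes "character f" "character g"
  shows "character (f \<star> g)"
  unfolding character_def
proof (intro allI)
  fix ws vs :: "'a list"
  have f: "f ws * f vs = sum_list (map f (shuffle_list ws vs))" for ws vs
    using assms(1) by (simp add: character_def)
  have g: "g ws * g vs = sum_list (map g (shuffle_list ws vs))" for ws vs
    using assms(2) by (simp add: character_def)
  have "(f \<star> g) ws * (f \<star> g) vs = (\<Sum>i\<le>length ws. \<Sum>j\<le>length vs.
      (f (take i ws) * f (take j vs)) * (g (drop i ws) * g (drop j vs)))"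
    by (simp add: conv_def sum_product mult.assoc mult.left_commute)
  also have "\<dots> = (\<Sum>i\<le>length ws. \<Sum>j\<le>length vs. \<Sum>a\<leftarrow>shuffle_list (take i ws) (take j vs).
        \<Sum>b\<leftarrow>shuffle_list (drop i ws) (drop j vs). f a * g b)"
    by (simp add: f g sum_list_mult_const sum_list_const_mult)
  also have "\<dots> = sum_list (map (f \<star> g) (shuffle_list ws vs))"
    by (simp add: sum_conv_shuffle_list[symmetric] conv_def[abs_def])
  finally show "(f \<star> g) ws * (f \<star> g) vs = sum_list (map (f \<star> g) (shuffle_list ws vs))" .
qed

lemma character_chen: "character (chen es)"
proof (induction es)
  case Nil
  have "empty_word ws * empty_word vs = sum_list (map empty_word (shuffle_list ws vs) :: 'b list)"
    for ws vs :: "'a list"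
  proof (cases "ws = [] \<or> vs = []")
    case True
    then show ?thesis by (auto simp: empty_word_def)
  next
    case False
    then have "z \<noteq> []" if "z \<in> set (shuffle_list ws vs)" for z
      using set_shuffle_list[OF that] by auto
    then have "map empty_word (shuffle_list ws vs) = map (\<lambda>_. 0::'b) (shuffle_list ws vs)"
      by (auto simp: empty_word_def)
    then have "sum_list (map empty_word (shuffle_list ws vs)) = (0::'b)"
      by (simp only: sum_list_triv) simp
    then show ?thesis using False by (auto simp: empty_word_def)
  qed
  then show ?case by (simp add: character_def)
next
  case (Cons e es)
  then show ?case by (simp add: character_conv character_exp_word)
qed

abbreviation index_seqs :: "nat \<Rightarrow> nat \<Rightarrow> nat list set" where
  "index_seqs n r \<equiv> {ts. length ts = r \<and> set ts \<subseteq> {1..n} \<and> sorted ts}"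

lemma finite_index_seqs: "finite (index_seqs n r)"
  by (rule finite_subset[OF _ finite_lists_length_eq[of "{1..n}" r]]) auto

text \<open>
  A weakly increasing sequence of indices starts with a block of ones, and the rest is such a sequence
  for the remaining indices. This is the recursion over the first step of a path.
\<close>

lemma index_seqs_Suc:
  "bij_betw (\<lambda>(i, ts). replicate i 1 @ map Suc ts)
     (SIGMA i:{..r}. index_seqs n (r - i)) (index_seqs (Suc n) r)"
proof (rule bij_betw_byWitness[where
      f' = "\<lambda>ts. (count_list ts 1, map (\<lambda>t. t - 1) (filter (\<lambda>t. t \<noteq> 1) ts))"])
  have c1: "count_list (replicate i 1 @ map Suc ts) 1 = i" if "set ts \<subseteq> {1..n}" for i ts
    using that by (induction i) (auto simp: count_list_0_iff)
  have c2: "map (\<lambda>t. t - 1) (filter (\<lambda>t. t \<noteq> 1) (replicate i 1 @ map Suc ts)) = ts"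
    if "set ts \<subseteq> {1..n}" for i ts
    using that by (induction ts) (auto simp: filter_replicate)
  show "\<forall>a\<in>(SIGMA i:{..r}. index_seqs n (r - i)).
      (\<lambda>ts. (count_list ts 1, map (\<lambda>t. t - 1) (filter (\<lambda>t. t \<noteq> 1) ts)))
        ((\<lambda>(i, ts). replicate i 1 @ map Suc ts) a) = a"
    using c1 c2 by (auto simp del: count_list_append filter_append map_append)
  have rebuild: "replicate (count_list ts 1) 1 @ map Suc (map (\<lambda>t. t - 1) (filter (\<lambda>t. t \<noteq> 1) ts)) = ts"
    if "sorted ts" "set ts \<subseteq> {1..Suc n}" for ts
    using that
  proof (induction ts)
    case Nil
    then show ?case by simp
  next
    case (Cons t ts)
    show ?case
    proof (cases "t = 1")
      case True
      then show ?thesis using Cons by simp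
    next
      case False
      then have "1 \<notin> set ts" using Cons.prems by fastforce
      then have "count_list ts 1 = 0" by simp
      then show ?thesis using Cons False by (auto simp: count_list_0_iff)
    qed
  qed
  then show "\<forall>ts\<in>index_seqs (Suc n) r. (\<lambda>(i, ts). replicate i 1 @ map Suc ts)
      (count_list ts 1, map (\<lambda>t. t - 1) (filter (\<lambda>t. t \<noteq> 1) ts)) = ts"
    by simp
  show "(\<lambda>(i, ts). replicate i 1 @ map Suc ts) ` (SIGMA i:{..r}. index_seqs n (r - i))
      \<subseteq> index_seqs (Suc n) r"
    by (fastforce simp: sorted_append sorted_map)
  have len: "count_list ts 1 + length (filter (\<lambda>t. t \<noteq> 1) ts) = length ts" for ts :: "nat list"
    by (induction ts) auto
  have "(count_list ts 1, map (\<lambda>t. t - 1) (filter (\<lambda>t. t \<noteq> 1) ts))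
      \<in> (SIGMA i:{..r}. index_seqs n (r - i))" if "ts \<in> index_seqs (Suc n) r" for ts
  proof -
    have "sorted (map (\<lambda>t. t - 1) (filter (\<lambda>t. t \<noteq> 1) ts))"
      using that by (auto simp: sorted_map intro!: sorted_wrt_filter
          intro: sorted_wrt_mono_rel[of _ "(\<le>)"])
    moreover have "set (map (\<lambda>t. t - 1) (filter (\<lambda>t. t \<noteq> 1) ts)) \<subseteq> {1..n}"
      using that by fastforce
    ultimately show ?thesis using that len[of ts] by auto
  qed
  then show "(\<lambda>ts. (count_list ts 1, map (\<lambda>t. t - 1) (filter (\<lambda>t. t \<noteq> 1) ts))) `
      index_seqs (Suc n) r \<subseteq> (SIGMA i:{..r}. index_seqs n (r - i))"
    by blast
qed

lemma mult_fact_Suc: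
  assumes "0 \<notin> set ts"
  shows "mult_fact (replicate i 1 @ map Suc ts) = fact i * mult_fact ts"
proof -
  have inj: "count_list (map Suc ts) (Suc k) = count_list ts k" for k
    by (induction ts) auto
  have 1: "count_list (map Suc ts) (Suc 0) = 0"
    using assms by (auto simp: count_list_0_iff)
  have rep: "count_list (replicate i (Suc 0)) k = (if k = Suc 0 then i else 0)" for k
    by (induction i) auto
  have "mult_fact (replicate i 1 @ map Suc ts) =
      (\<Prod>k \<in> insert 1 (Suc ` set ts). fact (count_list (replicate i 1 @ map Suc ts) k))"
    unfolding mult_fact_def by (rule prod.mono_neutral_left) (auto simp: rep 1)
  also have "\<dots> = fact i *
      (\<Prod>k \<in> Suc ` set ts. fact (count_list (replicate i 1 @ map Suc ts) k))"
    using assms by (subst prod.insert) (auto simp: rep 1)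
  also have "(\<Prod>k \<in> Suc ` set ts. fact (count_list (replicate i 1 @ map Suc ts) k)) = mult_fact ts"
    unfolding mult_fact_def using assms
    by (subst prod.reindex) (auto simp: rep inj intro!: prod.cong)
  finally show ?thesis .
qed

text \<open>
  The sum in the definition of iterated integrals is the expanded product of the exponentials of the
  steps.
\<close>

lemma chen_eq_sum_index_seqs:
  "chen es ws = (\<Sum>ts\<in>index_seqs (length es) (length ws).
     (\<Prod>i<length ws. (es ! (ts ! i - 1)) (ws ! i)) / of_nat (mult_fact ts))"
proof (induction es arbitrary: ws)
  case Nil
  have "index_seqs 0 (length ws) = (if ws = [] then {[]} else {})" by auto
  then show ?case by (simp add: empty_word_def mult_fact_def)
next
  case (Cons e es)
  let ?n = "length es" and ?r = "length ws"
  let ?t = "\<lambda>es ws ts. (\<Prod>i<length ws. (es ! (ts ! i - 1)) (ws ! i)) / of_nat (mult_fact ts)"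
  have term_eq: "?t (e # es) ws (replicate i 1 @ map Suc ts) =
      exp_word e (take i ws) * ?t es (drop i ws) ts"
    if i: "i \<le> ?r" and ts: "ts \<in> index_seqs ?n (?r - i)" for i ts
  proof -
    let ?f = "\<lambda>k. ((e # es) ! ((replicate i 1 @ map Suc ts) ! k - 1)) (ws ! k)"
    have split: "{..<?r} = {..<i} \<union> {i..<?r}" using i by auto
    have "(\<Prod>k<?r. ?f k) = (\<Prod>k<i. ?f k) * (\<Prod>k\<in>{i..<?r}. ?f k)"
      unfolding split by (rule prod.union_disjoint) auto
    also have "(\<Prod>k<i. ?f k) = (\<Prod>k<i. e (ws ! k))"
      by (rule prod.cong) (simp_all add: nth_append)
    also have "\<dots> = prod_list (map e (take i ws))"
      using i by (simp add: prod.list_conv_set_nth atLeast0LessThan min_def)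
    also have "(\<Prod>k\<in>{i..<?r}. ?f k) = (\<Prod>k<?r - i. ?f (i + k))"
      by (rule prod.reindex_bij_witness[of _ "\<lambda>k. i + k" "\<lambda>k. k - i"]) auto
    also have "\<dots> = (\<Prod>k<?r - i. (es ! (ts ! k - 1)) (drop i ws ! k))"
    proof (rule prod.cong)
      fix k assume "k \<in> {..<?r - i}"
      then have k: "k < length ts" using ts by simp
      then have "ts ! k \<in> set ts" by simp
      then have "ts ! k \<noteq> 0" using ts by auto
      then show "?f (i + k) = (es ! (ts ! k - 1)) (drop i ws ! k)"
        using k i by (simp add: nth_append nth_Cons')
    qed simp
    finally have "(\<Prod>k<?r. ?f k) =
      prod_list (map e (take i ws)) * (\<Prod>k<?r - i. (es ! (ts ! k - 1)) (drop i ws ! k))" .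
    moreover have "0 \<notin> set ts" using ts by auto
    ultimately show ?thesis
      using i by (simp add: mult_fact_Suc[unfolded One_nat_def] exp_word_def min_def)
  qed
  have "(\<Sum>ts\<in>index_seqs (length (e # es)) ?r. ?t (e # es) ws ts) =
      (\<Sum>(i, ts)\<in>(SIGMA i:{..?r}. index_seqs ?n (?r - i)).
        ?t (e # es) ws (replicate i 1 @ map Suc ts))"
    using sum.reindex_bij_betw[OF index_seqs_Suc[of ?r ?n], of "?t (e # es) ws"]
    by (simp add: case_prod_beta)
  also have "\<dots> = (\<Sum>i\<le>?r. \<Sum>ts\<in>index_seqs ?n (?r - i).
      ?t (e # es) ws (replicate i 1 @ map Suc ts))"
    by (rule sum.Sigma[symmetric]) (simp_all add: finite_index_seqs[unfolded One_nat_def])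
  also have "\<dots> = (\<Sum>i\<le>?r. \<Sum>ts\<in>index_seqs ?n (?r - i).
      exp_word e (take i ws) * ?t es (drop i ws) ts)"
    by (intro sum.cong refl term_eq) auto
  also have "\<dots> = (exp_word e \<star> chen es) ws"
    by (simp add: conv_def Cons.IH sum_distrib_left)
  finally show ?case by simp
qed

section \<open>Tensor squares of spaces of functions\<close>

text \<open>
  The value at a formal linear combination of the linear extension of \<open>f\<close> from the basis.
\<close>

definition linear_ext :: "('a \<Rightarrow> 'k) \<Rightarrow> ('a \<Rightarrow>\<^sub>0 'k::field) \<Rightarrow> 'k" where
  "linear_ext f t = (\<Sum>p\<in>Poly_Mapping.keys t. Poly_Mapping.lookup t p * f p)"

lemma linear_ext_superset:
  assumes "finite K" "Poly_Mapping.keys t \<subseteq> K"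
  shows "linear_ext f t = (\<Sum>p\<in>K. Poly_Mapping.lookup t p * f p)"
  unfolding linear_ext_def using assms
  by (intro sum.mono_neutral_left) (auto simp: in_keys_iff)

lemma linear_ext_zero [simp]: "linear_ext f 0 = 0"
  by (simp add: linear_ext_def)

lemma linear_ext_single [simp]: "linear_ext f (Poly_Mapping.single p c) = c * f p"
  by (cases "c = 0") (simp_all add: linear_ext_def)

lemma linear_ext_add: "linear_ext f (s + t) = linear_ext f s + linear_ext f t"
proof -
  let ?K = "Poly_Mapping.keys s \<union> Poly_Mapping.keys t"
  have "linear_ext f r = (\<Sum>p\<in>?K. Poly_Mapping.lookup r p * f p)"
    if "r \<in> {s + t, s, t}" for r
    using that keys_add[of s t] by (intro linear_ext_superset) auto
  then show ?thesis by (simp add: lookup_add algebra_simps sum.distrib)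
qed

lemma linear_ext_diff: "linear_ext f (s - t) = linear_ext f s - linear_ext f t"
  using linear_ext_add[of f "s - t" t] by simp

lemma linear_ext_sum: "linear_ext f (\<Sum>i\<in>I. t i) = (\<Sum>i\<in>I. linear_ext f (t i))"
  by (induction I rule: infinite_finite_induct) (simp_all add: linear_ext_add)

lemma linear_ext_sum_list: "linear_ext f (sum_list ts) = (\<Sum>t\<leftarrow>ts. linear_ext f t)"
  by (induction ts) (simp_all add: linear_ext_add)

lemma keys_map_mult: "Poly_Mapping.keys (Poly_Mapping.map ((*) c) t) \<subseteq> Poly_Mapping.keys (t :: 'a \<Rightarrow>\<^sub>0 'k::field)"
  by (auto simp: in_keys_iff Poly_Mapping.map.rep_eq when_def)

lemma lookup_map_mult:
  "Poly_Mapping.lookup (Poly_Mapping.map ((*) c) t) p = c * Poly_Mapping.lookup (t :: 'a \<Rightarrow>\<^sub>0 'k::field) p"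
  by (auto simp: Poly_Mapping.map.rep_eq when_def)

lemma linear_ext_scale: "linear_ext f (Poly_Mapping.map ((*) c) t) = c * linear_ext f t"
  by (subst linear_ext_superset[OF finite_keys keys_map_mult])
    (simp add: lookup_map_mult linear_ext_def sum_distrib_left mult.assoc)

lemma sum_single_lookup:
  "(\<Sum>p\<in>Poly_Mapping.keys t. Poly_Mapping.single p (Poly_Mapping.lookup t p)) = t"
proof (rule poly_mapping_eqI)
  fix q
  have "(\<Sum>p\<in>Poly_Mapping.keys t. if p = q then Poly_Mapping.lookup t p else 0) =
      Poly_Mapping.lookup t q"
    by (simp only: sum.delta finite_keys) (simp add: in_keys_iff)
  then show "Poly_Mapping.lookup (\<Sum>p\<in>Poly_Mapping.keys t.
      Poly_Mapping.single p (Poly_Mapping.lookup t p)) q = Poly_Mapping.lookup t q"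
    by (simp add: lookup_sum lookup_single when_def)
qed

lemma tensor_null_uminus: "t \<in> tensor_null A \<Longrightarrow> - t \<in> tensor_null A"
proof -
  assume t: "t \<in> tensor_null A"
  have "- t = Poly_Mapping.map ((*) (- 1)) t"
    by (rule poly_mapping_eqI) (simp add: lookup_map_mult)
  then show ?thesis using tensor_null.scale[OF t, of "- 1"] by simp
qed

lemma tensor_null_diff: "s \<in> tensor_null A \<Longrightarrow> t \<in> tensor_null A \<Longrightarrow> s - t \<in> tensor_null A"
  using tensor_null.plus[OF _ tensor_null_uminus, of s A t] by simp

lemma tensor_null_sum:
  "(\<And>i. i \<in> I \<Longrightarrow> t i \<in> tensor_null A) \<Longrightarrow> (\<Sum>i\<in>I. t i) \<in> tensor_null A"
  by (induction I rule: infinite_finite_induct) (simp_all add: tensor_null.zero tensor_null.plus)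

text \<open>
  A tensor of functions on \<open>X\<close> is also a function on \<open>X \<times> X\<close>. The aim of this part is that an
  element of a tensor square of a function space is determined by this function (\<open>null_iff_pairing\<close>
  below), so that statements about tensors become statements about values.
\<close>

definition pairing ::
    "(('x \<Rightarrow> 'k) \<times> ('x \<Rightarrow> 'k) \<Rightarrow>\<^sub>0 'k::field) \<Rightarrow> 'x \<Rightarrow> 'x \<Rightarrow> 'k" where
  "pairing t a b = linear_ext (\<lambda>(u, v). u a * v b) t"

abbreviation pure_sum :: "('u \<times> 'u) list \<Rightarrow> ('u \<times> 'u \<Rightarrow>\<^sub>0 'k::field)" where
  "pure_sum ps \<equiv> (\<Sum>p\<leftarrow>ps. Poly_Mapping.single p 1)"

locale function_space =
  fixes A :: "('k::field, 'x \<Rightarrow> 'k, 'm) module_scheme" and X :: "'x set"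
  assumes ext: "u \<in> carrier A \<Longrightarrow> u \<in> extensional X"
    and add_closed: "u \<in> carrier A \<Longrightarrow> v \<in> carrier A \<Longrightarrow> u \<oplus>\<^bsub>A\<^esub> v \<in> carrier A"
    and smult_closed: "u \<in> carrier A \<Longrightarrow> c \<odot>\<^bsub>A\<^esub> u \<in> carrier A"
    and add_eval: "u \<in> carrier A \<Longrightarrow> v \<in> carrier A \<Longrightarrow> a \<in> X \<Longrightarrow> (u \<oplus>\<^bsub>A\<^esub> v) a = u a + v a"
    and smult_eval: "u \<in> carrier A \<Longrightarrow> a \<in> X \<Longrightarrow> (c \<odot>\<^bsub>A\<^esub> u) a = c * u a"
begin

lemma eqI: "u \<in> carrier A \<Longrightarrow> v \<in> carrier A \<Longrightarrow> (\<And>a. a \<in> X \<Longrightarrow> u a = v a) \<Longrightarrow> u = v"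
  by (rule extensionalityI[OF ext ext])

lemma pairing_null:
  assumes "t \<in> tensor_null A" "a \<in> X" "b \<in> X"
  shows "pairing t a b = 0"
  using assms(1)
  by (induction rule: tensor_null.induct)
    (simp_all add: pairing_def linear_ext_add linear_ext_diff linear_ext_scale add_eval smult_eval
      assms(2,3) algebra_simps)

lemma swap_scalar_null:
  assumes "u \<in> carrier A" "v \<in> carrier A"
  shows "Poly_Mapping.single (u, c \<odot>\<^bsub>A\<^esub> v) 1 - Poly_Mapping.single (c \<odot>\<^bsub>A\<^esub> u, v) 1 \<in> tensor_null A"
  using tensor_null_diff[OF tensor_null.smult_right[OF assms, of c] tensor_null.smult_left[OF assms, of c]]
  by simp

lemma zero_left_null:
  assumes "u \<in> carrier A" "v \<in> carrier A" "\<And>a. a \<in> X \<Longrightarrow> u a = 0"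
  shows "Poly_Mapping.single (u, v) 1 \<in> tensor_null A"
proof -
  have "0 \<odot>\<^bsub>A\<^esub> u = u"
    using assms by (intro eqI) (auto simp: smult_closed smult_eval)
  then show ?thesis using tensor_null.smult_left[OF assms(1,2), of 0] by simp
qed

text \<open>
  Additivity in the right factor splits the tensor along the linear combination; its coefficients then
  move across the tensor sign, so that no new right factors appear and the number of terms can drop.
\<close>

lemma distribute_right:
  assumes u: "u \<in> carrier A" and v: "v \<in> carrier A"
    and ps: "set ps \<subseteq> carrier A \<times> carrier A"
    and eq: "\<And>b. b \<in> X \<Longrightarrow> v b = (\<Sum>(c, q)\<leftarrow>map (\<lambda>p. (k p, snd p)) ps. c * q b)"
  shows "Poly_Mapping.single (u, v) 1 - pure_sum (map (\<lambda>p. (k p \<odot>\<^bsub>A\<^esub> u, snd p)) ps)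
    \<in> tensor_null A"
  using v ps eq
proof (induction ps arbitrary: v)
  case Nil
  have "0 \<odot>\<^bsub>A\<^esub> v = v"
    using Nil by (intro eqI) (auto simp: smult_closed smult_eval)
  then show ?case using tensor_null.smult_right[OF u Nil(1), of 0] by simp
next
  case (Cons p ps)
  define q where "q = snd p"
  have q: "q \<in> carrier A" using Cons.prems by (auto simp: q_def)
  define w where "w = v \<oplus>\<^bsub>A\<^esub> ((- k p) \<odot>\<^bsub>A\<^esub> q)"
  have w: "w \<in> carrier A" using Cons.prems q by (simp add: w_def add_closed smult_closed)
  have kq: "k p \<odot>\<^bsub>A\<^esub> q \<in> carrier A" using q by (rule smult_closed)
  have v: "(k p \<odot>\<^bsub>A\<^esub> q) \<oplus>\<^bsub>A\<^esub> w = v"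
    using Cons.prems q w
    by (intro eqI) (auto simp: add_closed smult_closed add_eval smult_eval w_def)
  let ?S = "\<lambda>x y. Poly_Mapping.single (x, y) (1::'k)"
  have "?S u w - pure_sum (map (\<lambda>p. (k p \<odot>\<^bsub>A\<^esub> u, snd p)) ps) \<in> tensor_null A"
    using Cons.prems q
    by (intro Cons.IH w) (auto simp: add_eval smult_eval smult_closed w_def q_def o_def)
  moreover have "?S u v - ?S u (k p \<odot>\<^bsub>A\<^esub> q) - ?S u w \<in> tensor_null A"
    using tensor_null.add_right[OF u kq w] by (simp add: v)
  moreover have "?S u (k p \<odot>\<^bsub>A\<^esub> q) - ?S (k p \<odot>\<^bsub>A\<^esub> u) q \<in> tensor_null A"
    by (rule swap_scalar_null[OF u q])
  ultimately have "(?S u w - pure_sum (map (\<lambda>p. (k p \<odot>\<^bsub>A\<^esub> u, snd p)) ps)) +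
     (?S u v - ?S u (k p \<odot>\<^bsub>A\<^esub> q) - ?S u w) + (?S u (k p \<odot>\<^bsub>A\<^esub> q) - ?S (k p \<odot>\<^bsub>A\<^esub> u) q)
     \<in> tensor_null A"
    by (intro tensor_null.plus)
  then show ?case by (simp add: q_def algebra_simps)
qed

lemma merge_left:
  assumes u: "u \<in> carrier A" and ps: "set ps \<subseteq> carrier A \<times> carrier A"
  shows "pure_sum (map (\<lambda>p. (fst p \<oplus>\<^bsub>A\<^esub> (k p \<odot>\<^bsub>A\<^esub> u), snd p)) ps)
      - pure_sum ps - pure_sum (map (\<lambda>p. (k p \<odot>\<^bsub>A\<^esub> u, snd p)) ps) \<in> tensor_null A"
  using ps
proof (induction ps)
  case Nil
  show ?case by (simp add: tensor_null.zero)
next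
  case (Cons p ps)
  obtain a b where p: "p = (a, b)" by (cases p)
  have "a \<in> carrier A" "b \<in> carrier A" using Cons.prems p by auto
  then have "Poly_Mapping.single (a \<oplus>\<^bsub>A\<^esub> (k p \<odot>\<^bsub>A\<^esub> u), b) 1 - Poly_Mapping.single (a, b) 1
      - Poly_Mapping.single (k p \<odot>\<^bsub>A\<^esub> u, b) 1 \<in> tensor_null A"
    by (intro tensor_null.add_left smult_closed u)
  from tensor_null.plus[OF this Cons.IH] Cons.prems show ?case
    by (simp add: p algebra_simps)
qed

text \<open>
  Induction on the number of terms. If the first left factor \<open>u\<close> vanishes, its term is null.
  Otherwise evaluate the left factors at a point where \<open>u\<close> is nonzero: this writes the first right
  factor as a linear combination of the others, and bilinearity merges the first term into them.
\<close>

lemma pure_sum_null: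
  assumes "set ps \<subseteq> carrier A \<times> carrier A"
    and "\<And>a b. a \<in> X \<Longrightarrow> b \<in> X \<Longrightarrow> (\<Sum>(u, v)\<leftarrow>ps. u a * v b) = 0"
  shows "pure_sum ps \<in> tensor_null A"
  using assms
proof (induction "length ps" arbitrary: ps)
  case 0
  then show ?case by (simp add: tensor_null.zero)
next
  case (Suc n)
  then obtain u v qs where ps: "ps = (u, v) # qs" and n: "n = length qs"
    by (cases ps) auto
  have u: "u \<in> carrier A" and v: "v \<in> carrier A" and qs: "set qs \<subseteq> carrier A \<times> carrier A"
    using Suc.prems(1) ps by auto
  have eval: "u a * v b + (\<Sum>(u, v)\<leftarrow>qs. u a * v b) = 0" if "a \<in> X" "b \<in> X" for a b
    using Suc.prems(2)[OF that] ps by simp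
  show ?case
  proof (cases "\<forall>a\<in>X. u a = 0")
    case True
    have "pure_sum qs \<in> tensor_null A"
      using Suc.hyps(1)[OF n qs] eval True by simp
    then show ?thesis
      using zero_left_null[OF u v] True ps by (simp add: tensor_null.plus)
  next
    case False
    then obtain x where x: "x \<in> X" "u x \<noteq> 0" by blast
    \<comment> \<open>The coefficients come from solving the vanishing relation at \<open>x\<close> for the first right factor.\<close>
    define k where "k p = - (fst p x / u x)" for p :: "('x \<Rightarrow> 'k) \<times> ('x \<Rightarrow> 'k)"
    have vb: "v b = (\<Sum>p\<leftarrow>qs. k p * snd p b)" if "b \<in> X" for b
    proof -
      have "u x * (\<Sum>p\<leftarrow>qs. k p * snd p b) = - (\<Sum>(u, v)\<leftarrow>qs. u x * v b)"
        using x(2) by (induction qs) (auto simp: k_def field_simps)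
      also have "\<dots> = u x * v b" using eval[OF x(1) that] by (simp add: add_eq_0_iff2)
      finally show ?thesis using x(2) by simp
    qed
    define rs where "rs = map (\<lambda>p. (fst p \<oplus>\<^bsub>A\<^esub> (k p \<odot>\<^bsub>A\<^esub> u), snd p)) qs"
    have rs: "set rs \<subseteq> carrier A \<times> carrier A"
      using qs u by (auto simp: rs_def add_closed smult_closed)
    have "(\<Sum>(u, v)\<leftarrow>rs. u a * v b) = 0" if ab: "a \<in> X" "b \<in> X" for a b
    proof -
      have "(\<Sum>(u, v)\<leftarrow>rs. u a * v b) =
          (\<Sum>(u, v)\<leftarrow>qs. u a * v b) + u a * (\<Sum>p\<leftarrow>qs. k p * snd p b)"
        unfolding rs_def using qs u ab
        by (induction qs) (auto simp: add_eval smult_eval smult_closed algebra_simps)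
      then show ?thesis using eval[OF ab] vb[OF ab(2)] by (simp add: algebra_simps)
    qed
    then have 1: "pure_sum rs \<in> tensor_null A"
      using Suc.hyps(1)[of rs] n rs by (simp add: rs_def)
    have 2: "Poly_Mapping.single (u, v) 1 - pure_sum (map (\<lambda>p. (k p \<odot>\<^bsub>A\<^esub> u, snd p)) qs)
        \<in> tensor_null A"
      by (rule distribute_right[OF u v qs]) (simp add: vb o_def)
    have 3: "pure_sum rs - pure_sum qs - pure_sum (map (\<lambda>p. (k p \<odot>\<^bsub>A\<^esub> u, snd p)) qs)
        \<in> tensor_null A"
      unfolding rs_def by (rule merge_left[OF u qs])
    from tensor_null_diff[OF tensor_null.plus[OF 1 2] 3] show ?thesis
      by (simp add: ps algebra_simps)
  qed
qed

text \<open>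
  The canonical map from the tensor square of a space of functions on \<open>X\<close> to the functions on
  \<open>X \<times> X\<close> is well defined and injective.
\<close>

lemma null_iff_pairing:
  assumes keys: "Poly_Mapping.keys t \<subseteq> carrier A \<times> carrier A"
  shows "t \<in> tensor_null A \<longleftrightarrow> (\<forall>a\<in>X. \<forall>b\<in>X. pairing t a b = 0)"
proof
  assume "t \<in> tensor_null A"
  then show "\<forall>a\<in>X. \<forall>b\<in>X. pairing t a b = 0" by (simp add: pairing_null)
next
  assume zero: "\<forall>a\<in>X. \<forall>b\<in>X. pairing t a b = 0"
  obtain ks where ks: "set ks = Poly_Mapping.keys t" "distinct ks"
    using finite_distinct_list[OF finite_keys[of t]] by metis
  let ?c = "Poly_Mapping.lookup t"
  let ?ps = "map (\<lambda>p. (?c p \<odot>\<^bsub>A\<^esub> fst p, snd p)) ks"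
  have ps: "set ?ps \<subseteq> carrier A \<times> carrier A"
    using keys ks by (auto simp: smult_closed)
  have diff: "pure_sum ?ps - t \<in> tensor_null A"
  proof -
    have "pure_sum ?ps = (\<Sum>p\<in>Poly_Mapping.keys t.
        Poly_Mapping.single (?c p \<odot>\<^bsub>A\<^esub> fst p, snd p) (1::'k))"
      using ks by (simp add: sum_list_distinct_conv_sum_set o_def)
    then have "pure_sum ?ps - t = (\<Sum>p\<in>Poly_Mapping.keys t.
        Poly_Mapping.single (?c p \<odot>\<^bsub>A\<^esub> fst p, snd p) 1 - Poly_Mapping.single p (?c p))"
      by (simp only: sum_subtractf sum_single_lookup)
    also have "\<dots> \<in> tensor_null A"
    proof (rule tensor_null_sum)
      fix p assume "p \<in> Poly_Mapping.keys t"
      then have "fst p \<in> carrier A" "snd p \<in> carrier A" using keys by auto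
      from tensor_null.smult_left[OF this, of "?c p"]
      show "Poly_Mapping.single (?c p \<odot>\<^bsub>A\<^esub> fst p, snd p) 1 - Poly_Mapping.single p (?c p)
          \<in> tensor_null A" by simp
    qed
    finally show ?thesis .
  qed
  have "pure_sum ?ps \<in> tensor_null A"
  proof (rule pure_sum_null[OF ps])
    fix a b assume ab: "a \<in> X" "b \<in> X"
    have "pairing (pure_sum ps) a b = (\<Sum>(u, v)\<leftarrow>ps. u a * v b)"
      for ps :: "(('x \<Rightarrow> 'k) \<times> ('x \<Rightarrow> 'k)) list"
      by (induction ps) (auto simp: pairing_def linear_ext_add)
    then have "(\<Sum>(u, v)\<leftarrow>?ps. u a * v b) = pairing (pure_sum ?ps) a b" ..
    also have "\<dots> = pairing (pure_sum ?ps - t) a b + pairing t a b"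
      by (simp add: pairing_def linear_ext_diff)
    also have "\<dots> = 0" using pairing_null[OF diff ab] zero ab by simp
    finally show "(\<Sum>(u, v)\<leftarrow>?ps. u a * v b) = 0" .
  qed
  from tensor_null_diff[OF this diff] show "t \<in> tensor_null A" by simp
qed

end

section \<open>Walks and their homotopies\<close>

text \<open>
  Path maps are records over a line digraph, which are awkward to concatenate. A step records its
  source, its target and whether the arrow of the line digraph points forward; a path map is then a
  list of steps, concatenation is append, and reversal is again a list operation because a step
  carries its source.
\<close>

type_synonym 'a step = "'a \<times> bool \<times> 'a"

definition adj :: "'a pair_pre_digraph \<Rightarrow> 'a \<Rightarrow> 'a \<Rightarrow> bool" where
  "adj G u v \<longleftrightarrow> u = v \<or> (u, v) \<in> parcs G"

fun step_in :: "'a pair_pre_digraph \<Rightarrow> 'a step \<Rightarrow> bool" where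
  "step_in G (u, d, v) \<longleftrightarrow> u \<in> pverts G \<and> v \<in> pverts G \<and> (if d then adj G u v else adj G v u)"

fun walk :: "'a pair_pre_digraph \<Rightarrow> 'a \<Rightarrow> 'a step list \<Rightarrow> 'a \<Rightarrow> bool" where
  "walk G a [] b \<longleftrightarrow> a = b \<and> a \<in> pverts G"
| "walk G a ((u, d, v) # es) b \<longleftrightarrow> a = u \<and> step_in G (u, d, v) \<and> walk G v es b"

abbreviation flip_step :: "'a step \<Rightarrow> 'a step" where
  "flip_step \<equiv> \<lambda>(u, d, v). (v, \<not> d, u)"

definition rev_walk :: "'a step list \<Rightarrow> 'a step list" where
  "rev_walk es = rev (map flip_step es)"

definition map_walk :: "('a \<Rightarrow> 'b) \<Rightarrow> 'a step list \<Rightarrow> 'b step list" where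
  "map_walk g = map (\<lambda>(u, d, v). (g u, d, g v))"

text \<open>
  A digraph map on the cylinder of a shrinking map, read from left to right: \<open>E\<close> is the relation
  between the upper and lower vertices. A shrinking map either stays (the upper path makes a step
  alone) or moves on by one, in which case both paths step in the same direction.
\<close>

inductive prism :: "('a \<Rightarrow> 'a \<Rightarrow> bool) \<Rightarrow> 'a \<Rightarrow> 'a step list \<Rightarrow> 'a \<Rightarrow> 'a step list \<Rightarrow> bool" for E where
  base: "E a b \<Longrightarrow> prism E a [] b []"
| stay: "E a b \<Longrightarrow> prism E a' es b ts \<Longrightarrow> prism E a ((a, d, a') # es) b ts"
| move: "E a b \<Longrightarrow> prism E a' es b' ts \<Longrightarrow> prism E a ((a, d, a') # es) b ((b, d, b') # ts)"

text \<open>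
  The two disjuncts are the two orientations of the cylinder.
\<close>

definition walk_contracts ::
    "'a pair_pre_digraph \<Rightarrow> 'a \<Rightarrow> 'a \<Rightarrow> 'a step list \<Rightarrow> 'a step list \<Rightarrow> bool" where
  "walk_contracts G a b es ts \<longleftrightarrow> walk G a es b \<and> walk G a ts b \<and>
     (prism (adj G) a es a ts \<or> prism (\<lambda>u v. adj G v u) a es a ts)"

definition walk_homotopic ::
    "'a pair_pre_digraph \<Rightarrow> 'a \<Rightarrow> 'a \<Rightarrow> 'a step list \<Rightarrow> 'a step list \<Rightarrow> bool" where
  "walk_homotopic G a b = equivclp (walk_contracts G a b)"

lemma walk_start: "walk G a es b \<Longrightarrow> a \<in> pverts G"
  by (induction G a es b rule: walk.induct) auto

lemma walk_end: "walk G a es b \<Longrightarrow> b \<in> pverts G"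
  by (induction G a es b rule: walk.induct) auto

lemma walk_append: "walk G a (es @ fs) c \<longleftrightarrow> (\<exists>b. walk G a es b \<and> walk G b fs c)"
  by (induction es arbitrary: a) (auto dest: walk_start)

lemma walk_appendI: "walk G a es b \<Longrightarrow> walk G b fs c \<Longrightarrow> walk G a (es @ fs) c"
  by (auto simp: walk_append)

lemma walk_rev_walk: "walk G a es b \<Longrightarrow> walk G b (rev_walk es) a"
  by (induction G a es b rule: walk.induct) (auto simp: rev_walk_def walk_append)

lemma rev_walk_append: "rev_walk (es @ fs) = rev_walk fs @ rev_walk es"
  by (simp add: rev_walk_def)

lemma rev_walk_rev_walk [simp]: "rev_walk (rev_walk es) = es"
  by (induction es) (auto simp: rev_walk_def)

lemma map_walk_append: "map_walk g (es @ fs) = map_walk g es @ map_walk g fs"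
  by (simp add: map_walk_def)

lemma map_walk_rev_walk: "map_walk g (rev_walk es) = rev_walk (map_walk g es)"
  by (induction es) (auto simp: rev_walk_def map_walk_def)

lemma map_walk_comp: "map_walk g (map_walk f es) = map_walk (g \<circ> f) es"
  by (induction es) (auto simp: map_walk_def)

lemma map_walk_cong:
  "walk G a es b \<Longrightarrow> (\<And>v. v \<in> pverts G \<Longrightarrow> f v = g v) \<Longrightarrow> map_walk f es = map_walk g es"
  by (induction G a es b rule: walk.induct) (auto simp: map_walk_def)

lemma map_walk_id [simp]: "map_walk id es = es"
  by (induction es) (auto simp: map_walk_def)

lemma digraph_map_adj: "digraph_map G H g \<Longrightarrow> adj G u v \<Longrightarrow> adj H (g u) (g v)"
  by (auto simp: digraph_map_def adj_def)

lemma digraph_map_vertex: "digraph_map G H g \<Longrightarrow> u \<in> pverts G \<Longrightarrow> g u \<in> pverts H"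
  by (auto simp: digraph_map_def)

lemma walk_map_walk:
  assumes "digraph_map G H g"
  shows "walk G a es b \<Longrightarrow> walk H (g a) (map_walk g es) (g b)"
  by (induction es arbitrary: a)
    (auto simp: map_walk_def digraph_map_adj[OF assms] digraph_map_vertex[OF assms])

lemma prism_map_walk:
  assumes "\<And>u v. E u v \<Longrightarrow> E' (g u) (g v)"
  shows "prism E a es b ts \<Longrightarrow> prism E' (g a) (map_walk g es) (g b) (map_walk g ts)"
  by (induction rule: prism.induct) (auto simp: map_walk_def intro: prism.intros assms)

lemma prism_refl:
  assumes "\<And>u. E u u"
  shows "walk G a es b \<Longrightarrow> prism E a es a es"
  by (induction G a es b rule: walk.induct) (auto intro: prism.intros assms)

lemma prism_append:
  "prism E a es b ts \<Longrightarrow> walk G a es a' \<Longrightarrow> walk H b ts b' \<Longrightarrow> prism E a' fs b' us \<Longrightarrow>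
    prism E a (es @ fs) b (ts @ us)"
  by (induction rule: prism.induct) (auto intro: prism.intros)

lemma walk_homotopic_refl [simp]: "walk_homotopic G a b es es"
  by (simp add: walk_homotopic_def)

lemma walk_homotopic_sym: "walk_homotopic G a b es ts \<Longrightarrow> walk_homotopic G a b ts es"
  unfolding walk_homotopic_def by (rule equivclp_sym)

lemma walk_homotopic_trans [trans]:
  "walk_homotopic G a b es ts \<Longrightarrow> walk_homotopic G a b ts us \<Longrightarrow> walk_homotopic G a b es us"
  unfolding walk_homotopic_def by (rule equivclp_trans)

lemma walk_contracts_homotopic: "walk_contracts G a b es ts \<Longrightarrow> walk_homotopic G a b es ts"
  unfolding walk_homotopic_def by (rule r_into_equivclp)

lemma equivclp_image:
  assumes "\<And>x y. R x y \<Longrightarrow> S (f x) (f y)" "equivclp R x y"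
  shows "equivclp S (f x) (f y)"
  using assms(2)
  by (induction rule: equivclp_induct)
    (auto dest: assms(1) intro: r_into_equivclp equivclp_trans equivclp_sym)

lemma walk_homotopic_map_walk:
  assumes "digraph_map G H g" "walk_homotopic G a b es ts"
  shows "walk_homotopic H (g a) (g b) (map_walk g es) (map_walk g ts)"
  unfolding walk_homotopic_def
proof (rule equivclp_image[OF _ assms(2)[unfolded walk_homotopic_def]])
  fix es ts assume "walk_contracts G a b es ts"
  then show "walk_contracts H (g a) (g b) (map_walk g es) (map_walk g ts)"
    using prism_map_walk[of "adj G" "adj H" g a es a ts]
      prism_map_walk[of "\<lambda>u v. adj G v u" "\<lambda>u v. adj H v u" g a es a ts] assms(1)
    by (auto simp: walk_contracts_def walk_map_walk digraph_map_adj)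
qed

text \<open>
  A cylinder extends by the cylinders of identity maps on both sides.
\<close>

lemma walk_homotopic_whisker:
  assumes "walk_homotopic G a b es ts" "walk G c p a" "walk G b q d"
  shows "walk_homotopic G c d (p @ es @ q) (p @ ts @ q)"
  unfolding walk_homotopic_def
proof (rule equivclp_image[OF _ assms(1)[unfolded walk_homotopic_def]])
  fix es ts assume *: "walk_contracts G a b es ts"
  have "prism E c (p @ es @ q) c (p @ ts @ q)" if "prism E a es a ts" "\<And>u. E u u" for E
    using that * assms(2,3) unfolding walk_contracts_def
    by (meson prism_append prism_refl)
  with * assms(2,3) show "walk_contracts G c d (p @ es @ q) (p @ ts @ q)"
    by (auto simp: walk_contracts_def adj_def[abs_def] intro!: walk_appendI)
qed

lemma walk_homotopic_append:
  assumes "walk_homotopic G a b es ts" "walk_homotopic G b c fs us"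
    and "walk G a ts b" "walk G b fs c"
  shows "walk_homotopic G a c (es @ fs) (ts @ us)"
proof -
  have "walk_homotopic G a c ([] @ es @ fs) ([] @ ts @ fs)"
    using assms by (intro walk_homotopic_whisker) (auto dest: walk_start)
  moreover have "walk_homotopic G a c (ts @ fs @ []) (ts @ us @ [])"
    using assms by (intro walk_homotopic_whisker) (auto dest: walk_end)
  ultimately show ?thesis by (auto intro: walk_homotopic_trans)
qed

text \<open>
  A step followed by its reverse contracts to the constant walk: every vertex on it is adjacent or
  equal to the starting vertex. The walk is cancelled from its middle outwards.
\<close>

lemma walk_homotopic_cancel: "walk G a p b \<Longrightarrow> walk_homotopic G a a (p @ rev_walk p) []"
proof (induction G a p b rule: walk.induct)
  case (1 G a b)
  then show ?case by (simp add: rev_walk_def)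
next
  case (2 G a u d v es b)
  let ?e = "(u, d, v)"
  have e: "a = u" "walk G u [?e] v" "walk G v [flip_step ?e] u" and es: "walk G v es b"
    using 2 by (auto dest: walk_start)
  have "walk_homotopic G u u ([?e] @ (es @ rev_walk es) @ [flip_step ?e]) ([?e] @ [] @ [flip_step ?e])"
    using 2 e by (intro walk_homotopic_whisker) auto
  also have "walk_contracts G u u ([?e] @ [] @ [flip_step ?e]) []"
  proof -
    have "prism E u [?e, flip_step ?e] u []" if "E v u" "E u u" for E
      using that by (auto intro!: prism.intros)
    then show ?thesis
      using e by (auto simp: walk_contracts_def adj_def split: if_splits)
  qed
  then have "walk_homotopic G u u ([?e] @ [] @ [flip_step ?e]) []"
    by (rule walk_contracts_homotopic)
  finally show ?case using e by (simp add: rev_walk_def)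
qed

lemma walk_homotopic_cancel': "walk G a p b \<Longrightarrow> walk_homotopic G b b (rev_walk p @ p) []"
  using walk_homotopic_cancel[OF walk_rev_walk] by simp

lemma walk_homotopic_cancel_mid:
  assumes "walk G a p b" "walk G b q c" "walk G b r d"
  shows "walk_homotopic G a d (p @ q @ rev_walk q @ r) (p @ r)"
  using walk_homotopic_whisker[OF walk_homotopic_cancel[OF assms(2)] assms(1,3)] by simp

text \<open>
  If \<open>f v\<close> and \<open>g v\<close> are uniformly adjacent, the images of a walk under \<open>f\<close> and \<open>g\<close> bound a strip. The
  shrinking map collapses the two connecting edges at the ends and is the identity in between.
\<close>

lemma walk_homotopic_one_step:
  assumes f: "digraph_map G H f" and g: "digraph_map G H g"
    and E: "\<And>v. v \<in> pverts G \<Longrightarrow> if d then adj H (f v) (g v) else adj H (g v) (f v)"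
    and es: "walk G a es b"
  shows "walk_homotopic H (f a) (f b) (map_walk f es)
    ([(f a, d, g a)] @ map_walk g es @ [(g b, \<not> d, f b)])"
proof -
  have ab: "a \<in> pverts G" "b \<in> pverts G" using es by (auto dest: walk_start walk_end)
  have fg: "walk H (f v) [(f v, d, g v)] (g v)" "walk H (g v) [(g v, \<not> d, f v)] (f v)"
    if "v \<in> pverts G" for v
    using that E f g by (auto dest: digraph_map_vertex split: if_splits)
  have "prism E (f a) ((f a, d, g a) # map_walk g es @ [(g b, \<not> d, f b)]) (f a) (map_walk f es)"
    if "\<And>v. v \<in> pverts G \<Longrightarrow> E (g v) (f v)" "\<And>v. E v v" for E
  proof -
    have "prism E (g a) (map_walk g es @ [(g b, \<not> d, f b)]) (f a) (map_walk f es)"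
      using es
    proof (induction es arbitrary: a)
      case Nil
      then have "b \<in> pverts G" "a = b" by auto
      then show ?case
        by (auto simp: map_walk_def intro: that prism.base[of E "f b" "f b"] prism.stay[of E "g b" "f b"])
    next
      case (Cons e es)
      obtain u d v where e: "e = (u, d, v)" by (cases e)
      with Cons.prems have "a = u" "u \<in> pverts G" "walk G v es b" by auto
      then show ?case
        using Cons.IH[of v] by (simp add: map_walk_def e) (intro prism.move that)
    qed
    moreover have "E (f a) (f a)" by (rule that)
    ultimately show ?thesis by (simp add: prism.stay)
  qed
  note prisms = this
  have "prism (adj H) (f a) ([(f a, d, g a)] @ map_walk g es @ [(g b, \<not> d, f b)]) (f a) (map_walk f es)"
    if "\<not> d"
    using prisms[of "adj H"] E that by (simp add: adj_def)
  moreover have "prism (\<lambda>u v. adj H v u) (f a) ([(f a, d, g a)] @ map_walk g es @ [(g b, \<not> d, f b)])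
        (f a) (map_walk f es)" if d
    using prisms[of "\<lambda>u v. adj H v u"] E that by (simp add: adj_def)
  ultimately have "prism (adj H) (f a) ([(f a, d, g a)] @ map_walk g es @ [(g b, \<not> d, f b)]) (f a) (map_walk f es) \<or>
      prism (\<lambda>u v. adj H v u) (f a) ([(f a, d, g a)] @ map_walk g es @ [(g b, \<not> d, f b)])
        (f a) (map_walk f es)"
    by (cases d) simp_all
  then have "walk_contracts H (f a) (f b) ([(f a, d, g a)] @ map_walk g es @ [(g b, \<not> d, f b)])
      (map_walk f es)"
    unfolding walk_contracts_def
    by (intro conjI walk_map_walk[OF f es]
        walk_appendI[OF fg(1)[OF ab(1)] walk_appendI[OF walk_map_walk[OF g es] fg(2)[OF ab(2)]]])
  then show ?thesis by (rule walk_homotopic_sym[OF walk_contracts_homotopic])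
qed

lemma box_digraph_mapD:
  assumes F: "digraph_map (box_product G I) H F" and I: "line_digraph n I"
  shows "k \<le> n \<Longrightarrow> digraph_map G H (\<lambda>v. F (v, k))"
    and "k < n \<Longrightarrow> v \<in> pverts G \<Longrightarrow>
      if (k, Suc k) \<in> parcs I then adj H (F (v, k)) (F (v, Suc k))
      else adj H (F (v, Suc k)) (F (v, k))"
proof -
  have V: "pverts I = {0..n}" using I by (simp add: line_digraph_def)
  have Fv: "F (v, k) \<in> pverts H" if "v \<in> pverts G" "k \<le> n" for v k
    using F that V by (auto simp: digraph_map_def box_product_def)
  have Fe: "adj H (F p) (F q)" if "(p, q) \<in> parcs (box_product G I)" for p q
    using F that by (auto simp: digraph_map_def adj_def)
  show "digraph_map G H (\<lambda>v. F (v, k))" if k: "k \<le> n"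
  proof -
    have "adj H (F (u, k)) (F (v, k))" if "(u, v) \<in> parcs G" for u v
      using that k V by (intro Fe) (simp add: box_product_def)
    then show ?thesis using Fv k by (auto simp: digraph_map_def adj_def)
  qed
  show "if (k, Suc k) \<in> parcs I then adj H (F (v, k)) (F (v, Suc k))
      else adj H (F (v, Suc k)) (F (v, k))" if "k < n" "v \<in> pverts G"
    using that I Fe[of "(v, k)" "(v, Suc k)"] Fe[of "(v, Suc k)" "(v, k)"]
    by (auto simp: line_digraph_def box_product_def)
qed

text \<open>
  A homotopy moves the base point along a walk \<open>p\<close>, and the two images of a loop differ by conjugation
  with \<open>p\<close>: this is the composite of the one-step strips.
\<close>

lemma homotopic_maps_track:
  assumes "homotopic_maps G H f g" and a: "a \<in> pverts G"
  obtains p where "walk H (f a) p (g a)"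
    "\<And>es. walk G a es a \<Longrightarrow>
      walk_homotopic H (f a) (f a) (map_walk f es) (p @ map_walk g es @ rev_walk p)"
proof -
  from assms obtain n I F where I: "line_digraph n I"
    and F: "digraph_map (box_product G I) H F"
    and F0: "\<And>v. v \<in> pverts G \<Longrightarrow> F (v, 0) = f v" and Fn: "\<And>v. v \<in> pverts G \<Longrightarrow> F (v, n) = g v"
    unfolding homotopic_maps_def by blast
  let ?F = "\<lambda>k v. F (v, k)"
  have "\<exists>p. walk H (f a) p (?F k a) \<and> (\<forall>es. walk G a es a \<longrightarrow>
      walk_homotopic H (f a) (f a) (map_walk f es) (p @ map_walk (?F k) es @ rev_walk p))"
    if "k \<le> n" for k
    using that
  proof (induction k)
    case 0
    have "map_walk f es = map_walk (?F 0) es" if "walk G a es a" for es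
      by (rule map_walk_cong[OF that]) (simp add: F0)
    moreover have "?F 0 a \<in> pverts H"
      using box_digraph_mapD(1)[OF F I] a by (auto dest: digraph_map_vertex)
    ultimately show ?case
      using F0[OF a] by (intro exI[of _ "[]"]) (auto simp: rev_walk_def)
  next
    case (Suc k)
    then obtain p where p: "walk H (f a) p (?F k a)"
      and hom: "\<And>es. walk G a es a \<Longrightarrow>
        walk_homotopic H (f a) (f a) (map_walk f es) (p @ map_walk (?F k) es @ rev_walk p)"
      by auto
    define d where "d \<longleftrightarrow> (k, Suc k) \<in> parcs I"
    let ?e = "(?F k a, d, ?F (Suc k) a)"
    have maps: "digraph_map G H (?F k)" "digraph_map G H (?F (Suc k))"
      using box_digraph_mapD(1)[OF F I] Suc.prems by auto
    have e: "if d then adj H (?F k v) (?F (Suc k) v) else adj H (?F (Suc k) v) (?F k v)"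
      if "v \<in> pverts G" for v
      using box_digraph_mapD(2)[OF F I _ that, of k] Suc.prems by (simp add: d_def)
    have "walk H (?F k a) [?e] (?F (Suc k) a)"
      using e[OF a] maps a by (auto dest: digraph_map_vertex)
    then have "walk H (f a) (p @ [?e]) (?F (Suc k) a)"
      by (rule walk_appendI[OF p])
    moreover have "walk_homotopic H (f a) (f a) (map_walk f es)
        ((p @ [?e]) @ map_walk (?F (Suc k)) es @ rev_walk (p @ [?e]))" if es: "walk G a es a" for es
    proof -
      have "walk_homotopic H (f a) (f a) (p @ map_walk (?F k) es @ rev_walk p)
          (p @ ([?e] @ map_walk (?F (Suc k)) es @ [flip_step ?e]) @ rev_walk p)"
        using walk_homotopic_one_step[OF maps e es] p walk_rev_walk[OF p]
        by (intro walk_homotopic_whisker) auto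
      from walk_homotopic_trans[OF hom[OF es] this] show ?thesis
        by (simp add: rev_walk_def)
    qed
    ultimately show ?case by (intro exI[of _ "p @ [?e]"] conjI allI impI)
  qed
  from this[OF order_refl] obtain p where p: "walk H (f a) p (?F n a)" and
    hom: "\<forall>es. walk G a es a \<longrightarrow>
      walk_homotopic H (f a) (f a) (map_walk f es) (p @ map_walk (?F n) es @ rev_walk p)"
    by (elim exE conjE)
  show thesis
  proof (rule that)
    show "walk H (f a) p (g a)" using p unfolding Fn[OF a] .
    fix es assume es: "walk G a es a"
    have "map_walk (?F n) es = map_walk g es"
      by (rule map_walk_cong[OF es]) (rule Fn)
    with hom[rule_format, OF es]
    show "walk_homotopic H (f a) (f a) (map_walk f es) (p @ map_walk g es @ rev_walk p)"
      by (simp only:)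
  qed
qed

section \<open>Walks and path maps\<close>

definition walk_vertex :: "'a \<Rightarrow> 'a step list \<Rightarrow> nat \<Rightarrow> 'a" where
  "walk_vertex a es i = (a # map (snd \<circ> snd) es) ! i"

definition walk_dir :: "'a step list \<Rightarrow> nat \<Rightarrow> bool" where
  "walk_dir es i = fst (snd (es ! i))"

definition mk_path :: "'a \<Rightarrow> 'a step list \<Rightarrow> 'a path_map" where
  "mk_path a es = \<lparr>plen = length es,
     pline = \<lparr>pverts = {0..length es},
       parcs = (\<lambda>i. if walk_dir es i then (i, Suc i) else (Suc i, i)) ` {..<length es}\<rparr>,
     pmap = restrict (walk_vertex a es) {0..length es}\<rparr>"

definition steps_of :: "'a path_map \<Rightarrow> 'a step list" where
  "steps_of \<alpha> =
     map (\<lambda>i. (pmap \<alpha> i, (i, Suc i) \<in> parcs (pline \<alpha>), pmap \<alpha> (Suc i))) [0..<plen \<alpha>]"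

lemma walk_vertex_0 [simp]: "walk_vertex a es 0 = a"
  by (simp add: walk_vertex_def)

lemma walk_vertex_Cons [simp]: "walk_vertex a ((u, d, v) # es) (Suc i) = walk_vertex v es i"
  by (simp add: walk_vertex_def)

lemma walk_dir_Cons [simp]:
  "walk_dir ((u, d, v) # es) 0 = d" "walk_dir (e # es) (Suc i) = walk_dir es i"
  by (simp_all add: walk_dir_def)

lemma walk_vertex_length: "walk G a es b \<Longrightarrow> walk_vertex a es (length es) = b"
  by (induction es arbitrary: a) auto

lemma walk_nth:
  "walk G a es b \<Longrightarrow> i < length es \<Longrightarrow>
    es ! i = (walk_vertex a es i, walk_dir es i, walk_vertex a es (Suc i)) \<and> step_in G (es ! i)"
proof (induction es arbitrary: a i)
  case (Cons e es)
  then show ?case by (cases e; cases i) auto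
qed simp

lemma walk_vertex_in: "walk G a es b \<Longrightarrow> i \<le> length es \<Longrightarrow> walk_vertex a es i \<in> pverts G"
  using walk_nth[of G a es b i] walk_vertex_length[of G a es b] walk_end[of G a es b]
  by (cases "i = length es") auto

lemma mk_path_sel [simp]:
  "plen (mk_path a es) = length es"
  "pverts (pline (mk_path a es)) = {0..length es}"
  "i \<le> length es \<Longrightarrow> pmap (mk_path a es) i = walk_vertex a es i"
  by (simp_all add: mk_path_def)

lemma mk_path_arc:
  "(i, Suc i) \<in> parcs (pline (mk_path a es)) \<longleftrightarrow> i < length es \<and> walk_dir es i"
  "(Suc i, i) \<in> parcs (pline (mk_path a es)) \<longleftrightarrow> i < length es \<and> \<not> walk_dir es i"
  by (auto simp: mk_path_def split: if_splits)

lemma mk_path_arcE: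
  assumes "(p, q) \<in> parcs (pline (mk_path a es))"
  obtains i where "i < length es" "walk_dir es i" "p = i" "q = Suc i"
  | i where "i < length es" "\<not> walk_dir es i" "p = Suc i" "q = i"
  using assms by (auto simp: mk_path_def split: if_splits)

lemma line_digraph_mk_path: "line_digraph (length es) (pline (mk_path a es))"
  unfolding line_digraph_def by (auto simp: mk_path_arc) (erule mk_path_arcE; force)

lemma walk_adj:
  assumes "walk G a es b" "i < length es"
  shows "if walk_dir es i then adj G (walk_vertex a es i) (walk_vertex a es (Suc i))
    else adj G (walk_vertex a es (Suc i)) (walk_vertex a es i)"
  using walk_nth[OF assms] by (metis step_in.simps)

lemma path_map_mk_path: "walk G a es b \<Longrightarrow> path_map G (mk_path a es)"
proof -
  assume es: "walk G a es b"
  let ?\<alpha> = "mk_path a es"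
  have "pmap ?\<alpha> p = pmap ?\<alpha> q \<or> (pmap ?\<alpha> p, pmap ?\<alpha> q) \<in> parcs G"
    if "(p, q) \<in> parcs (pline ?\<alpha>)" for p q
    using that
    by (rule mk_path_arcE)
      (use walk_adj[OF es, of p] walk_adj[OF es, of q] in \<open>simp_all add: adj_def\<close>)
  moreover have "pmap ?\<alpha> i \<in> pverts G" if "i \<in> pverts (pline ?\<alpha>)" for i
    using that walk_vertex_in[OF es] by simp
  ultimately have "digraph_map (pline ?\<alpha>) G (pmap ?\<alpha>)"
    unfolding digraph_map_def by blast
  then show ?thesis
    using line_digraph_mk_path[of es a] by (simp add: path_map_def) (simp add: mk_path_def)
qed

lemma pstart_mk_path [simp]: "pstart (mk_path a es) = a"
  by (simp add: pstart_def)

lemma pend_mk_path: "walk G a es b \<Longrightarrow> pend (mk_path a es) = b"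
  by (simp add: pend_def walk_vertex_length)

lemma steps_of_mk_path: "walk G a es b \<Longrightarrow> steps_of (mk_path a es) = es"
  by (rule nth_equalityI) (auto simp: steps_of_def mk_path_arc dest: walk_nth)

lemma length_steps_of [simp]: "length (steps_of \<alpha>) = plen \<alpha>"
  by (simp add: steps_of_def)

lemma path_map_adj:
  assumes \<alpha>: "path_map G \<alpha>" and i: "i < plen \<alpha>"
  shows "if (i, Suc i) \<in> parcs (pline \<alpha>) then adj G (pmap \<alpha> i) (pmap \<alpha> (Suc i))
    else adj G (pmap \<alpha> (Suc i)) (pmap \<alpha> i)"
  using assms by (auto simp: path_map_def digraph_map_def line_digraph_def adj_def)

lemma path_map_vertex: "path_map G \<alpha> \<Longrightarrow> i \<le> plen \<alpha> \<Longrightarrow> pmap \<alpha> i \<in> pverts G"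
  by (auto simp: path_map_def digraph_map_def line_digraph_def)

lemma walk_steps_of:
  assumes "path_map G \<alpha>"
  shows "walk G (pstart \<alpha>) (steps_of \<alpha>) (pend \<alpha>)"
proof -
  let ?e = "\<lambda>i. (pmap \<alpha> i, (i, Suc i) \<in> parcs (pline \<alpha>), pmap \<alpha> (Suc i))"
  have "k \<le> plen \<alpha> \<Longrightarrow> walk G (pmap \<alpha> 0) (map ?e [0..<k]) (pmap \<alpha> k)" for k
  proof (induction k)
    case 0
    show ?case using path_map_vertex[OF assms, of 0] by simp
  next
    case (Suc k)
    have "walk G (pmap \<alpha> k) [?e k] (pmap \<alpha> (Suc k))"
      using path_map_adj[OF assms, of k] path_map_vertex[OF assms] Suc.prems by simp
    with Suc show ?case by (simp add: walk_appendI del: walk.simps)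
  qed
  then show ?thesis by (simp add: steps_of_def pstart_def pend_def)
qed

lemma walk_vertex_steps_of: "i \<le> plen \<alpha> \<Longrightarrow> walk_vertex (pstart \<alpha>) (steps_of \<alpha>) i = pmap \<alpha> i"
  by (cases i) (simp_all add: walk_vertex_def steps_of_def pstart_def)

lemma walk_dir_steps_of: "i < plen \<alpha> \<Longrightarrow> walk_dir (steps_of \<alpha>) i \<longleftrightarrow> (i, Suc i) \<in> parcs (pline \<alpha>)"
  by (simp add: walk_dir_def steps_of_def)

lemma mk_path_steps_of:
  assumes "path_map G \<alpha>"
  shows "mk_path (pstart \<alpha>) (steps_of \<alpha>) = \<alpha>"
proof -
  have line: "line_digraph (plen \<alpha>) (pline \<alpha>)" and ext: "pmap \<alpha> \<in> extensional {0..plen \<alpha>}"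
    using assms by (auto simp: path_map_def)
  have "pmap (mk_path (pstart \<alpha>) (steps_of \<alpha>)) = pmap \<alpha>"
    using ext by (intro extensionalityI[of _ "{0..plen \<alpha>}"])
      (simp_all add: mk_path_def walk_vertex_steps_of)
  moreover have "pline (mk_path (pstart \<alpha>) (steps_of \<alpha>)) = pline \<alpha>"
  proof (rule pair_pre_digraph.equality)
    show "pverts (pline (mk_path (pstart \<alpha>) (steps_of \<alpha>))) = pverts (pline \<alpha>)"
      using line by (simp add: line_digraph_def)
    have "(p, q) \<in> parcs (pline (mk_path (pstart \<alpha>) (steps_of \<alpha>))) \<longleftrightarrow> (p, q) \<in> parcs (pline \<alpha>)"
      for p q
    proof
      assume "(p, q) \<in> parcs (pline (mk_path (pstart \<alpha>) (steps_of \<alpha>)))"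
      then show "(p, q) \<in> parcs (pline \<alpha>)"
        by (rule mk_path_arcE) (use line in \<open>auto simp: walk_dir_steps_of line_digraph_def\<close>)
    next
      assume pq: "(p, q) \<in> parcs (pline \<alpha>)"
      then obtain i where i: "i < plen \<alpha>" "(p, q) = (i, Suc i) \<or> (p, q) = (Suc i, i)"
        using line unfolding line_digraph_def by blast
      then have "((i, Suc i) \<in> parcs (pline \<alpha>)) \<noteq> ((Suc i, i) \<in> parcs (pline \<alpha>))"
        using line by (simp add: line_digraph_def)
      with i pq show "(p, q) \<in> parcs (pline (mk_path (pstart \<alpha>) (steps_of \<alpha>)))"
        by (auto simp: mk_path_arc walk_dir_steps_of)
    qed
    then show "parcs (pline (mk_path (pstart \<alpha>) (steps_of \<alpha>))) = parcs (pline \<alpha>)" by auto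
  qed simp
  ultimately show ?thesis
    by (intro path_map.equality) simp_all
qed

lemma mk_path_in_loops: "walk G x es x \<Longrightarrow> mk_path x es \<in> loops G x"
  by (simp add: loops_def path_map_mk_path pend_mk_path)

lemma loopsE:
  assumes "\<alpha> \<in> loops G x"
  obtains es where "walk G x es x" "\<alpha> = mk_path x es"
proof
  have "path_map G \<alpha>" "pstart \<alpha> = x" "pend \<alpha> = x" using assms by (simp_all add: loops_def)
  then show "walk G x (steps_of \<alpha>) x" "\<alpha> = mk_path x (steps_of \<alpha>)"
    using walk_steps_of[of G \<alpha>] mk_path_steps_of[of G \<alpha>] by simp_all
qed

lemma const_loop_eq: "const_loop x = mk_path x []"
  by (auto simp: const_loop_def mk_path_def walk_vertex_def)

text \<open>
  The prism relation with its shrinking map made explicit. The step condition says that \<open>h\<close> is a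
  monotone digraph map of line digraphs.
\<close>

definition shadows ::
    "('a \<Rightarrow> 'a \<Rightarrow> bool) \<Rightarrow> 'a \<Rightarrow> 'a step list \<Rightarrow> 'a \<Rightarrow> 'a step list \<Rightarrow> (nat \<Rightarrow> nat) \<Rightarrow> bool" where
  "shadows E a es b ts h \<longleftrightarrow> h 0 = 0 \<and> h (length es) = length ts \<and>
    (\<forall>i<length es. h (Suc i) = h i \<or>
       h (Suc i) = Suc (h i) \<and> h i < length ts \<and> walk_dir es i = walk_dir ts (h i)) \<and>
    (\<forall>i\<le>length es. E (walk_vertex a es i) (walk_vertex b ts (h i)))"

lemma prism_shadows: "prism E a es b ts \<Longrightarrow> \<exists>h. shadows E a es b ts h"
proof (induction rule: prism.induct)
  case (base a b)
  then show ?case by (intro exI[of _ id]) (simp add: shadows_def)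
next
  case (stay a b a' es ts d)
  then obtain h where h: "shadows E a' es b ts h" by (elim exE)
  let ?h = "case_nat 0 h" and ?es = "(a, d, a') # es"
  have "?h (Suc i) = ?h i \<or>
      ?h (Suc i) = Suc (?h i) \<and> ?h i < length ts \<and> walk_dir ?es i = walk_dir ts (?h i)"
    if "i < length ?es" for i
    using that h by (cases i) (simp_all add: shadows_def)
  moreover have "E (walk_vertex a ?es i) (walk_vertex b ts (?h i))" if "i \<le> length ?es" for i
    using that h stay.hyps(1) by (cases i) (simp_all add: shadows_def)
  ultimately have "shadows E a ?es b ts ?h" using h by (simp add: shadows_def)
  then show ?case by (rule exI[of _ ?h])
next
  case (move a b a' es b' ts d)
  then obtain h where h: "shadows E a' es b' ts h" by (elim exE)
  let ?h = "case_nat 0 (\<lambda>i. Suc (h i))" and ?es = "(a, d, a') # es" and ?ts = "(b, d, b') # ts"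
  have "?h (Suc i) = ?h i \<or>
      ?h (Suc i) = Suc (?h i) \<and> ?h i < length ?ts \<and> walk_dir ?es i = walk_dir ?ts (?h i)"
    if "i < length ?es" for i
    using that h by (cases i) (simp_all add: shadows_def)
  moreover have "E (walk_vertex a ?es i) (walk_vertex b ?ts (?h i))" if "i \<le> length ?es" for i
    using that h move.hyps(1) by (cases i) (simp_all add: shadows_def)
  ultimately have "shadows E a ?es b ?ts ?h" using h by (simp add: shadows_def)
  then show ?case by (rule exI[of _ ?h])
qed

lemma walk_contracts_one_step:
  assumes "walk_contracts G a b es ts"
  shows "one_step_C_homotopic G (mk_path a es) (mk_path a ts)"
proof -
  let ?I = "pline (mk_path a es)" and ?J = "pline (mk_path a ts)"
  let ?F = "case_sum (pmap (mk_path a es)) (pmap (mk_path a ts))"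
  have es: "walk G a es b" and ts: "walk G a ts b"
    using assms by (auto simp: walk_contracts_def)
  note paths = path_map_mk_path[OF es] path_map_mk_path[OF ts]
  have I: "digraph_map ?I G (pmap (mk_path a es))" and J: "digraph_map ?J G (pmap (mk_path a ts))"
    using paths by (auto simp: path_map_def)
  have main: "\<exists>h. shrinking_map (length es) ?I (length ts) ?J h \<and>
      (\<forall>i\<le>length es. E (walk_vertex a es i) (walk_vertex a ts (h i)))"
    if "prism E a es a ts" for E
  proof -
    from prism_shadows[OF that] obtain h where sh: "shadows E a es a ts h" by (elim exE)
    then have h: "h 0 = 0" "h (length es) = length ts"
      and advance: "\<And>i. i < length es \<Longrightarrow> h (Suc i) = h i \<or>
          h (Suc i) = Suc (h i) \<and> h i < length ts \<and> walk_dir es i = walk_dir ts (h i)"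
      and E: "\<And>i. i \<le> length es \<Longrightarrow> E (walk_vertex a es i) (walk_vertex a ts (h i))"
      by (simp_all add: shadows_def)
    have mono: "h i \<le> h j" if "i \<le> j" "j \<le> length es" for i j
      using that
    proof (induction j rule: dec_induct)
      case (step n)
      then show ?case using advance[of n] by auto
    qed simp
    have le: "h i \<le> i" if "i \<le> length es" for i
      using that
    proof (induction i)
      case (Suc i)
      then show ?case using advance[of i] by auto
    qed (simp add: h)
    have "h p = h q \<or> (h p, h q) \<in> parcs ?J" if "(p, q) \<in> parcs ?I" for p q
      using that by (rule mk_path_arcE) (use advance in \<open>fastforce simp: mk_path_arc\<close>)+
    then have "digraph_map ?I ?J h"
      using mono[of _ "length es"] h by (auto simp: digraph_map_def)
    then show ?thesis
      using h mono le[of "length es"] E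
      by (intro exI[of _ h]) (auto simp: shrinking_map_def mono_on_def)
  qed
  from assms consider "prism (adj G) a es a ts" | "prism (\<lambda>u v. adj G v u) a es a ts"
    by (auto simp: walk_contracts_def)
  then obtain h where h: "shrinking_map (length es) ?I (length ts) ?J h"
    and F: "digraph_map (cylinder ?I ?J h) G ?F \<or> digraph_map (cylinder_minus ?I ?J h) G ?F"
  proof cases
    case 1
    from main[OF this] obtain h where h: "shrinking_map (length es) ?I (length ts) ?J h"
      and E: "\<forall>i\<le>length es. adj G (walk_vertex a es i) (walk_vertex a ts (h i))" by blast
    have "h i \<le> length ts" if "i \<le> length es" for i
      using h that by (auto simp: shrinking_map_def digraph_map_def)
    with E I J have "digraph_map (cylinder ?I ?J h) G ?F"
      by (auto simp: digraph_map_def cylinder_def adj_def Pi_iff)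
    with h show thesis by (intro that) auto
  next
    case 2
    from main[OF this] obtain h where h: "shrinking_map (length es) ?I (length ts) ?J h"
      and E: "\<forall>i\<le>length es. adj G (walk_vertex a ts (h i)) (walk_vertex a es i)" by blast
    have "h i \<le> length ts" if "i \<le> length es" for i
      using h that by (auto simp: shrinking_map_def digraph_map_def)
    with E I J have "digraph_map (cylinder_minus ?I ?J h) G ?F"
      by (auto simp: digraph_map_def cylinder_minus_def adj_def Pi_iff)
    with h show thesis by (intro that) auto
  qed
  then show ?thesis
    unfolding one_step_C_homotopic_def
    using paths pend_mk_path[OF es] pend_mk_path[OF ts] by (auto intro!: exI[of _ h] exI[of _ ?F])
qed

text \<open>
  A monotone digraph map between line digraphs advances by at most one, so the prism is built from
  the right end of the cylinder to the left one.
\<close>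

lemma shrinking_map_prism:
  assumes \<alpha>: "path_map G \<alpha>" and \<beta>: "path_map G \<beta>"
    and h: "shrinking_map (plen \<alpha>) (pline \<alpha>) (plen \<beta>) (pline \<beta>) h"
    and E: "\<And>i. i \<le> plen \<alpha> \<Longrightarrow> E (pmap \<alpha> i) (pmap \<beta> (h i))"
  shows "prism E (pstart \<alpha>) (steps_of \<alpha>) (pstart \<beta>) (steps_of \<beta>)"
proof -
  let ?e = "\<lambda>\<alpha> i. (pmap \<alpha> i, (i, Suc i) \<in> parcs (pline \<alpha>), pmap \<alpha> (Suc i))"
  have I: "line_digraph (plen \<alpha>) (pline \<alpha>)" and J: "line_digraph (plen \<beta>) (pline \<beta>)"
    using \<alpha> \<beta> by (auto simp: path_map_def)
  have drop_step: "drop i (steps_of \<gamma>) = ?e \<gamma> i # drop (Suc i) (steps_of \<gamma>)"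
    if "i < plen \<gamma>" for i and \<gamma> :: "'a path_map"
    using that Cons_nth_drop_Suc[of i "steps_of \<gamma>"] by (simp add: steps_of_def)
  have "prism E (pmap \<alpha> i) (drop i (steps_of \<alpha>)) (pmap \<beta> (h i)) (drop (h i) (steps_of \<beta>))"
    if "i \<le> plen \<alpha>" for i
    using that
  proof (induction i rule: inc_induct)
    case base
    show ?case
      using E[of "plen \<alpha>"] h by (simp add: shrinking_map_def prism.base[where E = E])
  next
    case (step i)
    have i: "i < plen \<alpha>" using step.hyps by simp
    have mono: "h i \<le> h (Suc i)" and le: "h (Suc i) \<le> plen \<beta>"
      and arcs: "\<And>p q. (p, q) \<in> parcs (pline \<alpha>) \<Longrightarrow> h p = h q \<or> (h p, h q) \<in> parcs (pline \<beta>)"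
      using h i I J by (auto simp: shrinking_map_def mono_on_def digraph_map_def line_digraph_def)
    have Ei: "E (pmap \<alpha> i) (pmap \<beta> (h i))" using E i by simp
    show ?case
    proof (cases "h (Suc i) = h i")
      case True
      then show ?thesis using step.IH Ei by (simp add: drop_step[OF i] prism.stay)
    next
      case False
      then have lt: "h i < h (Suc i)" using mono by simp
      have arcI: "((i, Suc i) \<in> parcs (pline \<alpha>)) \<noteq> ((Suc i, i) \<in> parcs (pline \<alpha>))"
        using I i by (simp add: line_digraph_def)
      then have arcJ: "(h i, h (Suc i)) \<in> parcs (pline \<beta>) \<or> (h (Suc i), h i) \<in> parcs (pline \<beta>)"
        using arcs[of i "Suc i"] arcs[of "Suc i" i] False by auto
      then have Suc: "h (Suc i) = Suc (h i)" and hi: "h i < plen \<beta>"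
        using J lt unfolding line_digraph_def by auto
      have "((h i, Suc (h i)) \<in> parcs (pline \<beta>)) \<noteq> ((Suc (h i), h i) \<in> parcs (pline \<beta>))"
        using J hi by (simp add: line_digraph_def)
      then have "(i, Suc i) \<in> parcs (pline \<alpha>) \<longleftrightarrow> (h i, Suc (h i)) \<in> parcs (pline \<beta>)"
        using arcs[of i "Suc i"] arcs[of "Suc i" i] arcI Suc by auto
      then show ?thesis
        using step.IH Ei by (simp add: drop_step[OF i] drop_step[OF hi] Suc prism.move)
    qed
  qed
  from this[of 0] show ?thesis using h by (simp add: pstart_def shrinking_map_def)
qed

lemma one_step_walk_contracts:
  assumes "one_step_C_homotopic G \<alpha> \<beta>"
  shows "walk_contracts G (pstart \<alpha>) (pend \<alpha>) (steps_of \<alpha>) (steps_of \<beta>)"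
proof -
  from assms obtain h F where \<alpha>: "path_map G \<alpha>" and \<beta>: "path_map G \<beta>"
    and ends: "pstart \<beta> = pstart \<alpha>" "pend \<beta> = pend \<alpha>"
    and h: "shrinking_map (plen \<alpha>) (pline \<alpha>) (plen \<beta>) (pline \<beta>) h"
    and F: "digraph_map (cylinder (pline \<alpha>) (pline \<beta>) h) G F \<or>
        digraph_map (cylinder_minus (pline \<alpha>) (pline \<beta>) h) G F"
    and F\<alpha>: "\<forall>i\<in>{0..plen \<alpha>}. F (Inl i) = pmap \<alpha> i"
    and F\<beta>: "\<forall>j\<in>{0..plen \<beta>}. F (Inr j) = pmap \<beta> j"
    unfolding one_step_C_homotopic_def by metis
  have V: "pverts (pline \<alpha>) = {0..plen \<alpha>}" "pverts (pline \<beta>) = {0..plen \<beta>}"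
    using \<alpha> \<beta> by (auto simp: path_map_def line_digraph_def)
  have Fi: "F (Inl i) = pmap \<alpha> i" "F (Inr (h i)) = pmap \<beta> (h i)" if "i \<le> plen \<alpha>" for i
    using that h F\<alpha> F\<beta> V by (auto simp: shrinking_map_def digraph_map_def)
  from F have "(\<forall>i\<le>plen \<alpha>. adj G (F (Inl i)) (F (Inr (h i)))) \<or>
      (\<forall>i\<le>plen \<alpha>. adj G (F (Inr (h i))) (F (Inl i)))"
  proof
    assume *: "digraph_map (cylinder (pline \<alpha>) (pline \<beta>) h) G F"
    have "adj G (F (Inl i)) (F (Inr (h i)))" if "i \<le> plen \<alpha>" for i
      using that by (intro digraph_map_adj[OF *]) (simp add: adj_def cylinder_def V)
    then show ?thesis by blast
  next
    assume *: "digraph_map (cylinder_minus (pline \<alpha>) (pline \<beta>) h) G F"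
    have "adj G (F (Inr (h i))) (F (Inl i))" if "i \<le> plen \<alpha>" for i
      using that by (intro digraph_map_adj[OF *]) (simp add: adj_def cylinder_minus_def V)
    then show ?thesis by blast
  qed
  then have "prism (adj G) (pstart \<alpha>) (steps_of \<alpha>) (pstart \<beta>) (steps_of \<beta>) \<or>
      prism (\<lambda>u v. adj G v u) (pstart \<alpha>) (steps_of \<alpha>) (pstart \<beta>) (steps_of \<beta>)"
    using shrinking_map_prism[OF \<alpha> \<beta> h, of "adj G"]
      shrinking_map_prism[OF \<alpha> \<beta> h, of "\<lambda>u v. adj G v u"] Fi by auto
  then show ?thesis
    using walk_steps_of[OF \<alpha>] walk_steps_of[OF \<beta>] by (simp add: walk_contracts_def ends)
qed

lemma C_homotopic_mk_path:
  "walk_homotopic G a b es ts \<Longrightarrow> C_homotopic G (mk_path a es) (mk_path a ts)"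
  unfolding walk_homotopic_def C_homotopic_def
  by (erule equivclp_image[rotated]) (rule walk_contracts_one_step)

lemma walk_homotopic_steps_of:
  assumes "C_homotopic G \<alpha> \<beta>"
  shows "walk_homotopic G (pstart \<alpha>) (pend \<alpha>) (steps_of \<alpha>) (steps_of \<beta>)"
proof -
  have "pstart \<beta> = pstart \<alpha> \<and> pend \<beta> = pend \<alpha> \<and>
      walk_homotopic G (pstart \<alpha>) (pend \<alpha>) (steps_of \<alpha>) (steps_of \<beta>)"
    using assms unfolding C_homotopic_def
  proof (induction rule: equivclp_induct)
    case (step \<beta> \<gamma>)
    from step.hyps(2) have "pstart \<gamma> = pstart \<beta> \<and> pend \<gamma> = pend \<beta> \<and>
        walk_homotopic G (pstart \<beta>) (pend \<beta>) (steps_of \<beta>) (steps_of \<gamma>)"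
    proof
      assume *: "one_step_C_homotopic G \<beta> \<gamma>"
      then show ?thesis
        using walk_contracts_homotopic[OF one_step_walk_contracts[OF *]]
        by (simp add: one_step_C_homotopic_def)
    next
      assume *: "one_step_C_homotopic G \<gamma> \<beta>"
      then show ?thesis
        using walk_homotopic_sym[OF walk_contracts_homotopic[OF one_step_walk_contracts[OF *]]]
        by (simp add: one_step_C_homotopic_def)
    qed
    with step.IH show ?case by (auto intro: walk_homotopic_trans)
  qed simp
  then show ?thesis by simp
qed

text \<open>
  Every intermediate path in a chain of one-step homotopies is a path map with the same ends, so
  passing to lists of steps loses nothing.
\<close>

lemma C_homotopic_iff_walk_homotopic:
  assumes "walk G a es b" "walk G a ts b"
  shows "C_homotopic G (mk_path a es) (mk_path a ts) \<longleftrightarrow> walk_homotopic G a b es ts"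
  using walk_homotopic_steps_of[of G "mk_path a es" "mk_path a ts"] C_homotopic_mk_path[of G a b es ts]
  by (auto simp: steps_of_mk_path[OF assms(1)] steps_of_mk_path[OF assms(2)] pend_mk_path[OF assms(1)])

text \<open>
  A step as a functional on forms; an iterated integral depends on the path only through these
  functionals.
\<close>

definition step_value :: "'a step \<Rightarrow> ('a \<times> 'a \<Rightarrow> 'k::field_char_0) \<Rightarrow> 'k" where
  "step_value = (\<lambda>(u, d, v) \<omega>. if u = v then 0 else if d then \<omega> (u, v) else - \<omega> (v, u))"

definition walk_integral :: "('a \<times> 'a \<Rightarrow> 'k::field_char_0) list \<Rightarrow> 'a step list \<Rightarrow> 'k" where
  "walk_integral ws es = chen (map step_value es) ws"

lemma iter_integral_eq:
  fixes ws :: "('a \<times> 'a \<Rightarrow> 'k::field_char_0) list"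
  shows "iter_integral ws \<alpha> = walk_integral ws (steps_of \<alpha>)"
proof -
  have form: "form_at \<omega> \<alpha> t = (map step_value (steps_of \<alpha>) ! (t - 1)) \<omega>"
    if "t \<in> {1..plen \<alpha>}" for t and \<omega> :: "'a \<times> 'a \<Rightarrow> 'k"
    using that by (cases t) (auto simp: form_at_def steps_of_def step_value_def)
  have "(\<Prod>i<length ws. form_at (ws ! i) \<alpha> (ts ! i)) =
      (\<Prod>i<length ws. (map step_value (steps_of \<alpha>) ! (ts ! i - 1)) (ws ! i))"
    if "ts \<in> index_seqs (plen \<alpha>) (length ws)" for ts
  proof (rule prod.cong)
    fix i assume "i \<in> {..<length ws}"
    then have "ts ! i \<in> set ts" using that by simp
    then have "ts ! i \<in> {1..plen \<alpha>}" using that by auto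
    then show "form_at (ws ! i) \<alpha> (ts ! i) =
        (map step_value (steps_of \<alpha>) ! (ts ! i - 1)) (ws ! i)" by (rule form)
  qed simp
  then show ?thesis
    by (simp add: iter_integral_def walk_integral_def chen_eq_sum_index_seqs)
qed

text \<open>
  Chen's formula: the comultiplication of words is dual to concatenation of walks.
\<close>

lemma walk_integral_append:
  "walk_integral ws (es @ fs) =
    (\<Sum>i\<le>length ws. walk_integral (take i ws) es * walk_integral (drop i ws) fs)"
  by (simp add: walk_integral_def chen_append conv_def)

text \<open>
  Reversing a walk reverses the product of exponentials and negates the exponents: the antipode is
  dual to reversal.
\<close>

lemma walk_integral_rev_walk:
  fixes ws :: "('a \<times> 'a \<Rightarrow> 'k::field_char_0) list"
  shows "walk_integral ws (rev_walk es) = (- 1) ^ length ws * walk_integral (rev ws) es"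
proof -
  have "map step_value (rev_walk es) =
      rev (map (\<lambda>e w. - e w) (map step_value es :: (('a \<times> 'a \<Rightarrow> 'k) \<Rightarrow> 'k) list))"
    by (induction es) (auto simp: rev_walk_def step_value_def fun_eq_iff)
  then show ?thesis
    by (simp only: walk_integral_def chen_rev_uminus word_flip_def)
qed

lemma walk_integral_mult:
  fixes ws vs :: "('a \<times> 'a \<Rightarrow> 'k::field_char_0) list"
  shows "walk_integral ws es * walk_integral vs es =
    (\<Sum>z\<leftarrow>shuffle_list ws vs. walk_integral z es)"
  using character_chen[of "map step_value es :: (('a \<times> 'a \<Rightarrow> 'k) \<Rightarrow> 'k) list"]
  by (simp add: walk_integral_def character_def)

lemma walk_integral_Nil_word: "walk_integral [] es = 1"
  by (simp add: walk_integral_def chen_Nil_word)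

text \<open>
  An arrow that \<open>g\<close> collapses carries the value zero, in agreement with the convention for constant
  steps in iterated integrals.
\<close>

definition pullback_form ::
    "'b pair_pre_digraph \<Rightarrow> ('b \<Rightarrow> 'a) \<Rightarrow> ('a \<times> 'a \<Rightarrow> 'k::field_char_0) \<Rightarrow> ('b \<times> 'b \<Rightarrow> 'k)" where
  "pullback_form H g \<omega> = (\<lambda>(u, v) \<in> parcs H. if g u = g v then 0 else \<omega> (g u, g v))"

lemma walk_integral_map_walk:
  fixes ws :: "('a \<times> 'a \<Rightarrow> 'k::field_char_0) list"
  assumes "walk H a es b"
  shows "walk_integral ws (map_walk g es) = walk_integral (map (pullback_form H g) ws) es"
proof -
  have step: "step_value (g u, d, g v) = step_value (u, d, v) \<circ> pullback_form H g"
    if "step_in H (u, d, v)" for u d v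
    using that by (cases d) (auto simp: step_value_def pullback_form_def adj_def fun_eq_iff)
  have "(map step_value (map_walk g es) :: (('a \<times> 'a \<Rightarrow> 'k) \<Rightarrow> 'k) list) =
      map (\<lambda>e. step_value e \<circ> pullback_form H g) es"
    using assms
  proof (induction es arbitrary: a)
    case (Cons e es)
    obtain u d v where e: "e = (u, d, v)" by (cases e)
    with Cons.prems have "step_in H (u, d, v)" "walk H v es b" by simp_all
    from step[OF this(1)] Cons.IH[OF this(2)] show ?case by (simp add: e map_walk_def o_def)
  qed (simp add: map_walk_def)
  then show ?thesis by (simp add: walk_integral_def chen_map_word o_def)
qed

section \<open>The Hopf algebra of iterated integrals in terms of walks\<close>

lemma loop_function_eqI:
  assumes "u \<in> extensional (loops G x)" "v \<in> extensional (loops G x)"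
    and "\<And>es. walk G x es x \<Longrightarrow> u (mk_path x es) = v (mk_path x es)"
  shows "u = v"
  by (rule extensionalityI[OF assms(1,2)]) (auto elim!: loopsE simp: assms(3))

lemma ball_loops: "(\<forall>\<alpha>\<in>loops G x. P \<alpha>) \<longleftrightarrow> (\<forall>es. walk G x es x \<longrightarrow> P (mk_path x es))"
proof
  assume "\<forall>\<alpha>\<in>loops G x. P \<alpha>"
  then show "\<forall>es. walk G x es x \<longrightarrow> P (mk_path x es)" by (simp add: mk_path_in_loops)
next
  assume P: "\<forall>es. walk G x es x \<longrightarrow> P (mk_path x es)"
  show "\<forall>\<alpha>\<in>loops G x. P \<alpha>"
  proof
    fix \<alpha> assume "\<alpha> \<in> loops G x"
    then show "P \<alpha>" using P by (elim loopsE) simp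
  qed
qed

lemma loop_integral_walk:
  "walk G x es x \<Longrightarrow> loop_integral G x ws (mk_path x es) = walk_integral ws es"
  by (simp add: loop_integral_def mk_path_in_loops iter_integral_eq steps_of_mk_path)

lemma word_value_walk:
  "walk G x es x \<Longrightarrow> word_value G x c (mk_path x es) = linear_ext (\<lambda>ws. walk_integral ws es) c"
  by (simp add: word_value_def mk_path_in_loops loop_integral_walk linear_ext_def)

lemma Q_carrier_extensional: "u \<in> Q_carrier G x \<Longrightarrow> u \<in> extensional (loops G x)"
  by (induction rule: Q_carrier.induct) (simp_all only: loop_integral_def restrict_extensional)

lemma loop_integral_in_Q:
  assumes "ws \<in> lists (one_forms G)"
  shows "loop_integral G x ws \<in> Q_carrier G x"
proof (cases "ws = []")
  case True
  have "loop_integral G x ws = (\<lambda>\<alpha>\<in>loops G x. 1)"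
    by (simp add: True loop_integral_def iter_integral_eq walk_integral_Nil_word)
  then show ?thesis by (simp only: Q_carrier.one)
qed (use assms in \<open>simp add: Q_carrier.gen\<close>)

lemma Q_carrier_sum:
  assumes "finite I" "\<And>i. i \<in> I \<Longrightarrow> u i \<in> Q_carrier G x"
  shows "(\<lambda>\<alpha>\<in>loops G x. \<Sum>i\<in>I. u i \<alpha>) \<in> Q_carrier G x"
  using assms
proof (induction I)
  case empty
  have "(\<lambda>\<alpha>\<in>loops G x. \<Sum>i\<in>{}. u i \<alpha>) = (\<lambda>\<alpha>\<in>loops G x. 0 * (\<lambda>\<alpha>\<in>loops G x. 1) \<alpha>)"
    by (rule restrict_ext) simp
  then show ?case by (simp only: Q_carrier.smult[OF Q_carrier.one])
next
  case (insert i I)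
  then have "(\<lambda>\<alpha>\<in>loops G x. u i \<alpha> + (\<lambda>\<alpha>\<in>loops G x. \<Sum>i\<in>I. u i \<alpha>) \<alpha>) \<in> Q_carrier G x"
    by (intro Q_carrier.add) auto
  moreover have "(\<lambda>\<alpha>\<in>loops G x. \<Sum>i\<in>insert i I. u i \<alpha>) =
      (\<lambda>\<alpha>\<in>loops G x. u i \<alpha> + (\<lambda>\<alpha>\<in>loops G x. \<Sum>i\<in>I. u i \<alpha>) \<alpha>)"
    using insert.hyps by (intro restrict_ext) simp
  ultimately show ?case by (simp only:)
qed

lemma word_combs_single: "ws \<in> lists (one_forms G) \<Longrightarrow> Poly_Mapping.single ws k \<in> word_combs G"
  by (simp add: word_combs_def)

lemma word_combs_add: "c \<in> word_combs G \<Longrightarrow> d \<in> word_combs G \<Longrightarrow> c + d \<in> word_combs G"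
  using keys_add[of c d] unfolding word_combs_def by blast

lemma word_combs_sum: "(\<And>i. i \<in> I \<Longrightarrow> c i \<in> word_combs G) \<Longrightarrow> (\<Sum>i\<in>I. c i) \<in> word_combs G"
  by (induction I rule: infinite_finite_induct) (auto simp: word_combs_add, simp_all add: word_combs_def)

lemma word_combs_sum_list: "(\<And>i. i \<in> set xs \<Longrightarrow> c i \<in> word_combs G) \<Longrightarrow> (\<Sum>i\<leftarrow>xs. c i) \<in> word_combs G"
  by (induction xs) (auto simp: word_combs_add, simp_all add: word_combs_def)

text \<open>
  Products of iterated integrals are sums over shuffles, so linear combinations of words exhaust the
  algebra. Without this, the comultiplication and the antipode, which are prescribed on words, would
  not be defined on all of it.
\<close>

lemma Q_carrier_word_value:
  assumes "u \<in> Q_carrier G x"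
  obtains c where "c \<in> word_combs G" "word_value G x c = u"
proof -
  have "\<exists>c\<in>word_combs G. \<forall>es. walk G x es x \<longrightarrow>
      u (mk_path x es) = linear_ext (\<lambda>ws. walk_integral ws es) c"
    using assms
  proof (induction rule: Q_carrier.induct)
    case one
    show ?case
      by (intro bexI[of _ "Poly_Mapping.single [] 1"])
        (simp_all add: mk_path_in_loops walk_integral_Nil_word word_combs_single)
  next
    case (gen ws)
    then show ?case
      by (intro bexI[of _ "Poly_Mapping.single ws 1"])
        (simp_all add: loop_integral_walk word_combs_single)
  next
    case (add u v)
    then obtain c d where "c \<in> word_combs G" "d \<in> word_combs G"
      "\<forall>es. walk G x es x \<longrightarrow> u (mk_path x es) = linear_ext (\<lambda>ws. walk_integral ws es) c"
      "\<forall>es. walk G x es x \<longrightarrow> v (mk_path x es) = linear_ext (\<lambda>ws. walk_integral ws es) d"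
      by (elim bexE)
    then show ?case
      by (intro bexI[of _ "c + d"])
        (simp_all add: mk_path_in_loops word_combs_add linear_ext_add)
  next
    case (mult u v)
    then obtain c d where c: "c \<in> word_combs G" and d: "d \<in> word_combs G"
      and u: "\<forall>es. walk G x es x \<longrightarrow> u (mk_path x es) = linear_ext (\<lambda>ws. walk_integral ws es) c"
      and v: "\<forall>es. walk G x es x \<longrightarrow> v (mk_path x es) = linear_ext (\<lambda>ws. walk_integral ws es) d"
      by (elim bexE)
    let ?k = "\<lambda>p q. Poly_Mapping.lookup c p * Poly_Mapping.lookup d q"
    let ?m = "\<Sum>p\<in>Poly_Mapping.keys c. \<Sum>q\<in>Poly_Mapping.keys d.
        \<Sum>z\<leftarrow>shuffle_list p q. Poly_Mapping.single z (?k p q)"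
    have "set z \<subseteq> one_forms G"
      if "p \<in> Poly_Mapping.keys c" "q \<in> Poly_Mapping.keys d" "z \<in> set (shuffle_list p q)" for p q z
      using that c d set_shuffle_list[OF that(3)] by (auto simp: word_combs_def)
    then have "?m \<in> word_combs G"
      by (intro word_combs_sum word_combs_sum_list word_combs_single) auto
    moreover have "linear_ext (\<lambda>ws. walk_integral ws es) ?m =
        linear_ext (\<lambda>ws. walk_integral ws es) c * linear_ext (\<lambda>ws. walk_integral ws es) d" for es
    proof -
      have "linear_ext (\<lambda>ws. walk_integral ws es) ?m =
          (\<Sum>p\<in>Poly_Mapping.keys c. \<Sum>q\<in>Poly_Mapping.keys d.
             ?k p q * (walk_integral p es * walk_integral q es))"
        by (simp add: linear_ext_sum linear_ext_sum_list o_def walk_integral_mult sum_list_const_mult)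
      also have "\<dots> = linear_ext (\<lambda>ws. walk_integral ws es) c * linear_ext (\<lambda>ws. walk_integral ws es) d"
        by (simp add: linear_ext_def sum_product mult.assoc mult.left_commute)
      finally show ?thesis .
    qed
    ultimately show ?case
      using u v by (intro bexI[of _ ?m]) (simp_all add: mk_path_in_loops)
  next
    case (smult u k)
    then obtain c where "c \<in> word_combs G"
      "\<forall>es. walk G x es x \<longrightarrow> u (mk_path x es) = linear_ext (\<lambda>ws. walk_integral ws es) c"
      by (elim bexE)
    then show ?case
      using keys_map_mult[of k c] by (intro bexI[of _ "Poly_Mapping.map ((*) k) c"])
        (auto simp: mk_path_in_loops linear_ext_scale word_combs_def)
  qed
  then obtain c where c: "c \<in> word_combs G" "\<forall>es. walk G x es x \<longrightarrow>
      u (mk_path x es) = linear_ext (\<lambda>ws. walk_integral ws es) c"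
    by (elim bexE)
  have "word_value G x c = u"
    by (rule loop_function_eqI[OF _ Q_carrier_extensional[OF assms]])
      (simp_all add: word_value_walk c(2), simp add: word_value_def)
  with c(1) show thesis by (rule that)
qed

lemma function_space_Q: "function_space (Q_algebra G x) (loops G x)"
  by unfold_locales (auto simp: Q_algebra_def Q_carrier_extensional Q_carrier.intros)

lemma pairing_word_comult:
  assumes "walk G x es x" "walk G x fs x"
  shows "pairing (word_comult G x c) (mk_path x es) (mk_path x fs) =
    word_value G x c (mk_path x (es @ fs))"
  using assms
  by (simp add: pairing_def word_comult_def linear_ext_sum loop_integral_walk word_value_walk
      walk_appendI walk_integral_append linear_ext_def[of _ c] sum_distrib_left)

lemma keys_word_comult:
  assumes "c \<in> word_combs G"
  shows "Poly_Mapping.keys (word_comult G x c) \<subseteq> Q_carrier G x \<times> Q_carrier G x"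
proof -
  have "loop_integral G x (take i ws) \<in> Q_carrier G x \<and> loop_integral G x (drop i ws) \<in> Q_carrier G x"
    if "ws \<in> Poly_Mapping.keys c" for ws i
    using that assms set_take_subset[of i ws] set_drop_subset[of i ws]
    by (intro conjI loop_integral_in_Q) (auto simp: word_combs_def)
  then show ?thesis
    unfolding word_comult_def
    by (intro order.trans[OF keys_sum] UN_least) (auto split: if_splits)
qed

lemma UN_eq_constant: "A \<noteq> {} \<Longrightarrow> (\<And>c. c \<in> A \<Longrightarrow> f c = R) \<Longrightarrow> (\<Union>c\<in>A. f c) = R"
  by auto

text \<open>
  The comultiplication of \<open>u\<close> consists of all tensors that represent the function sending a pair of
  loops to the value of \<open>u\<close> at their concatenation. Hence it does not depend on how \<open>u\<close> is written in
  words: by Chen's formula the tensor obtained from any presentation represents this function, and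
  tensors with equal functions are equal.
\<close>

lemma Q_comult_eq:
  assumes u: "u \<in> Q_carrier G x"
  shows "Q_comult G x u = {s. Poly_Mapping.keys s \<subseteq> Q_carrier G x \<times> Q_carrier G x \<and>
    (\<forall>es fs. walk G x es x \<longrightarrow> walk G x fs x \<longrightarrow>
       pairing s (mk_path x es) (mk_path x fs) = u (mk_path x (es @ fs)))}"
    (is "_ = ?R")
proof -
  interpret function_space "Q_algebra G x" "loops G x" by (rule function_space_Q)
  have carrier: "carrier (Q_algebra G x) = Q_carrier G x" by (simp add: Q_algebra_def)
  have "tensor_class (Q_algebra G x) (word_comult G x c) = ?R"
    if c: "c \<in> word_combs G" "word_value G x c = u" for c
  proof -
    have "s \<in> tensor_class (Q_algebra G x) (word_comult G x c) \<longleftrightarrow> s \<in> ?R" for s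
    proof (cases "Poly_Mapping.keys s \<subseteq> Q_carrier G x \<times> Q_carrier G x")
      case True
      then have keys: "Poly_Mapping.keys (s - word_comult G x c) \<subseteq> Q_carrier G x \<times> Q_carrier G x"
        using keys_diff[of s "word_comult G x c"] keys_word_comult[OF c(1), of x] by blast
      have "s - word_comult G x c \<in> tensor_null (Q_algebra G x) \<longleftrightarrow>
          (\<forall>es fs. walk G x es x \<longrightarrow> walk G x fs x \<longrightarrow>
            pairing (s - word_comult G x c) (mk_path x es) (mk_path x fs) = 0)"
        unfolding null_iff_pairing[unfolded carrier, OF keys] ball_loops by blast
      also have "\<dots> \<longleftrightarrow> (\<forall>es fs. walk G x es x \<longrightarrow> walk G x fs x \<longrightarrow>
            pairing s (mk_path x es) (mk_path x fs) = u (mk_path x (es @ fs)))"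
        using pairing_word_comult[of G x _ _ c] c(2) by (simp add: pairing_def linear_ext_diff)
      finally show ?thesis using True by (simp add: tensor_class_def carrier)
    qed (simp add: tensor_class_def carrier)
    show ?thesis by (rule Set.set_eqI) fact
  qed
  moreover obtain c where "c \<in> word_combs G" "word_value G x c = u"
    by (rule Q_carrier_word_value[OF u])
  ultimately have "{c \<in> word_combs G. word_value G x c = u} \<noteq> {}"
    and "\<And>c. c \<in> {c \<in> word_combs G. word_value G x c = u} \<Longrightarrow>
      tensor_class (Q_algebra G x) (word_comult G x c) = ?R"
    by auto
  then show ?thesis unfolding Q_comult_def by (rule UN_eq_constant)
qed

text \<open>
  The antipode is precomposition with reversal of loops; again this does not depend on the presentation
  of \<open>u\<close> by words, as the description by \<open>THE\<close> requires.
\<close>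

lemma Q_antipode_walk:
  assumes u: "u \<in> Q_carrier G x"
  shows "Q_antipode G x u \<in> extensional (loops G x)"
    and "walk G x es x \<Longrightarrow> Q_antipode G x u (mk_path x es) = u (mk_path x (rev_walk es))"
proof -
  let ?v = "\<lambda>\<alpha>\<in>loops G x. u (mk_path x (rev_walk (steps_of \<alpha>)))"
  have v: "word_antipode G x c = ?v" if "word_value G x c = u" for c
  proof (rule loop_function_eqI)
    fix es assume es: "walk G x es x"
    show "word_antipode G x c (mk_path x es) = ?v (mk_path x es)"
      using es walk_rev_walk[OF es] unfolding that[symmetric]
      by (simp add: word_antipode_def mk_path_in_loops loop_integral_walk steps_of_mk_path
          word_value_walk linear_ext_def walk_integral_rev_walk)
  qed (simp_all add: word_antipode_def)
  obtain c where "c \<in> word_combs G" "word_value G x c = u"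
    by (rule Q_carrier_word_value[OF u])
  then have "Q_antipode G x u = ?v"
    unfolding Q_antipode_def using v by (intro the_equality) auto
  then show "Q_antipode G x u \<in> extensional (loops G x)"
    and "walk G x es x \<Longrightarrow> Q_antipode G x u (mk_path x es) = u (mk_path x (rev_walk es))"
    by (simp_all add: mk_path_in_loops steps_of_mk_path)
qed

lemma pi1_carrier_iff:
  "u \<in> pi1_carrier G x \<longleftrightarrow> u \<in> Q_carrier G x \<and>
    (\<forall>es ts. walk G x es x \<longrightarrow> walk G x ts x \<longrightarrow> walk_homotopic G x x es ts \<longrightarrow>
       u (mk_path x es) = u (mk_path x ts))"
  unfolding pi1_carrier_def ball_loops by (auto simp: C_homotopic_iff_walk_homotopic)

lemma pi1_hopf_sel:
  "carrier (pi1_hopf G x) = pi1_carrier G x"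
  "monoid.mult (pi1_hopf G x) = (\<lambda>u v. \<lambda>\<alpha>\<in>loops G x. u \<alpha> * v \<alpha>)"
  "one (pi1_hopf G x) = (\<lambda>\<alpha>\<in>loops G x. 1)"
  "add (pi1_hopf G x) = (\<lambda>u v. \<lambda>\<alpha>\<in>loops G x. u \<alpha> + v \<alpha>)"
  "smult (pi1_hopf G x) = (\<lambda>c u. \<lambda>\<alpha>\<in>loops G x. c * u \<alpha>)"
  "counit (pi1_hopf G x) = Q_counit x"
  "comult (pi1_hopf G x) u =
     {t \<in> Q_comult G x u. Poly_Mapping.keys t \<subseteq> pi1_carrier G x \<times> pi1_carrier G x}"
  "antipode (pi1_hopf G x) = Q_antipode G x"
  by (simp_all add: pi1_hopf_def hopf_sub_def Q_hopf_def Q_algebra_def module.defs hopf_algebra.defs)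

lemma pi1_carrierD:
  assumes "u \<in> pi1_carrier G x"
  shows "u \<in> Q_carrier G x"
    and "walk G x es x \<Longrightarrow> walk G x ts x \<Longrightarrow> walk_homotopic G x x es ts \<Longrightarrow>
      u (mk_path x es) = u (mk_path x ts)"
  using assms unfolding pi1_carrier_iff by blast+

lemma function_space_pi1: "function_space (pi1_hopf G x) (loops G x)"
proof
  fix u v :: "'a path_map \<Rightarrow> 'b" and c and \<alpha>
  assume u: "u \<in> carrier (pi1_hopf G x)"
  note u = u[unfolded pi1_hopf_sel]
  note uQ = pi1_carrierD(1)[OF u]
  show "u \<in> extensional (loops G x)" by (rule Q_carrier_extensional[OF uQ])
  show "c \<odot>\<^bsub>pi1_hopf G x\<^esub> u \<in> carrier (pi1_hopf G x)"
    unfolding pi1_hopf_sel pi1_carrier_iff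
  proof (intro conjI allI impI Q_carrier.smult[OF uQ])
    fix es ts assume *: "walk G x es x" "walk G x ts x" "walk_homotopic G x x es ts"
    show "(\<lambda>\<alpha>\<in>loops G x. c * u \<alpha>) (mk_path x es) = (\<lambda>\<alpha>\<in>loops G x. c * u \<alpha>) (mk_path x ts)"
      using *(1,2) pi1_carrierD(2)[OF u *] by (simp add: mk_path_in_loops)
  qed
  show "\<alpha> \<in> loops G x \<Longrightarrow> (c \<odot>\<^bsub>pi1_hopf G x\<^esub> u) \<alpha> = c * u \<alpha>"
    unfolding pi1_hopf_sel by simp
  assume v: "v \<in> carrier (pi1_hopf G x)"
  note v = v[unfolded pi1_hopf_sel]
  show "u \<oplus>\<^bsub>pi1_hopf G x\<^esub> v \<in> carrier (pi1_hopf G x)"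
    unfolding pi1_hopf_sel pi1_carrier_iff
  proof (intro conjI allI impI Q_carrier.add[OF uQ pi1_carrierD(1)[OF v]])
    fix es ts assume *: "walk G x es x" "walk G x ts x" "walk_homotopic G x x es ts"
    show "(\<lambda>\<alpha>\<in>loops G x. u \<alpha> + v \<alpha>) (mk_path x es) = (\<lambda>\<alpha>\<in>loops G x. u \<alpha> + v \<alpha>) (mk_path x ts)"
      using *(1,2) pi1_carrierD(2)[OF u *] pi1_carrierD(2)[OF v *] by (simp add: mk_path_in_loops)
  qed
  show "\<alpha> \<in> loops G x \<Longrightarrow> (u \<oplus>\<^bsub>pi1_hopf G x\<^esub> v) \<alpha> = u \<alpha> + v \<alpha>"
    unfolding pi1_hopf_sel by simp
qed

section \<open>Transport of loops along a digraph map and a walk\<close>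

text \<open>
  A loop \<open>es\<close> at \<open>y\<close> is mapped by \<open>g\<close>, and the walk \<open>c\<close> from \<open>g y\<close> to \<open>x\<close> moves the result to the
  base point \<open>x\<close>.
\<close>

definition transport :: "('b \<Rightarrow> 'a) \<Rightarrow> 'a step list \<Rightarrow> 'b step list \<Rightarrow> 'a step list" where
  "transport g c es = rev_walk c @ map_walk g es @ c"

definition pull ::
    "'b pair_pre_digraph \<Rightarrow> 'b \<Rightarrow> 'a \<Rightarrow> ('b \<Rightarrow> 'a) \<Rightarrow> 'a step list \<Rightarrow>
      ('a path_map \<Rightarrow> 'k) \<Rightarrow> ('b path_map \<Rightarrow> 'k)" where
  "pull H y x g c u = (\<lambda>\<beta>\<in>loops H y. u (mk_path x (transport g c (steps_of \<beta>))))"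

lemma transport_rev_walk: "transport g c (rev_walk es) = rev_walk (transport g c es)"
  by (simp add: transport_def map_walk_rev_walk rev_walk_append)

text \<open>
  The map on representatives of tensors that underlies \<open>tensor_map\<close>.
\<close>

definition push :: "('u \<Rightarrow> 'v) \<Rightarrow> ('u \<times> 'u \<Rightarrow>\<^sub>0 'k::field) \<Rightarrow> ('v \<times> 'v \<Rightarrow>\<^sub>0 'k)" where
  "push \<phi> t = (\<Sum>(u, v)\<in>Poly_Mapping.keys t.
     Poly_Mapping.single (\<phi> u, \<phi> v) (Poly_Mapping.lookup t (u, v)))"

lemma keys_push:
  assumes "\<phi> ` A \<subseteq> B" "Poly_Mapping.keys t \<subseteq> A \<times> A"
  shows "Poly_Mapping.keys (push \<phi> t) \<subseteq> B \<times> B"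
  unfolding push_def
proof (intro order.trans[OF keys_sum] UN_least)
  fix p assume "p \<in> Poly_Mapping.keys t"
  then have "fst p \<in> A" "snd p \<in> A" using assms(2) by auto
  then have "\<phi> (fst p) \<in> B" "\<phi> (snd p) \<in> B" using assms(1) by blast+
  then show "Poly_Mapping.keys (case p of (u, v) \<Rightarrow>
      Poly_Mapping.single (\<phi> u, \<phi> v) (Poly_Mapping.lookup t (u, v))) \<subseteq> B \<times> B"
    by (simp add: case_prod_beta)
qed

lemma pairing_push: "pairing (push \<phi> t) a b = linear_ext (\<lambda>(u, v). \<phi> u a * \<phi> v b) t"
  unfolding pairing_def push_def linear_ext_sum
  by (simp add: case_prod_beta) (simp add: linear_ext_def case_prod_beta)

lemma linear_ext_cong:
  "(\<And>p. p \<in> Poly_Mapping.keys t \<Longrightarrow> f p = g p) \<Longrightarrow> linear_ext f t = linear_ext g t"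
  by (simp add: linear_ext_def)

text \<open>
  For a tensor of homotopy invariant functions, arguments may be replaced by homotopic ones.
\<close>

lemma pairing_cong:
  assumes "Poly_Mapping.keys t \<subseteq> A \<times> A" "\<And>u. u \<in> A \<Longrightarrow> u a = u a'" "\<And>u. u \<in> A \<Longrightarrow> u b = u b'"
  shows "pairing t a b = pairing t a' b'"
  unfolding pairing_def
proof (rule linear_ext_cong)
  fix p assume "p \<in> Poly_Mapping.keys t"
  then have "fst p \<in> A" "snd p \<in> A" using assms(1) by auto
  then show "(case p of (u, v) \<Rightarrow> u a * v b) = (case p of (u, v) \<Rightarrow> u a' * v b')"
    by (simp add: case_prod_beta assms(2,3))
qed

lemma walk_homotopic_conj_loop:
  assumes p: "walk G a p b" and es: "walk G b es b"
  shows "walk_homotopic G b b (rev_walk p @ p @ es @ rev_walk p @ p) es"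
proof -
  note cancel = walk_homotopic_cancel'[OF p]
  have "walk_homotopic G b b (es @ rev_walk p @ p) (es @ [])"
    by (rule walk_homotopic_append[OF walk_homotopic_refl cancel es])
      (rule walk_appendI[OF walk_rev_walk[OF p] p])
  then have "walk_homotopic G b b ((rev_walk p @ p) @ es @ rev_walk p @ p) ([] @ es @ [])"
    by (rule walk_homotopic_append[OF cancel])
      (use p es walk_rev_walk[OF p] in \<open>auto intro!: walk_appendI dest: walk_start\<close>)
  then show ?thesis by simp
qed

locale based_map =
  fixes H :: "'b pair_pre_digraph" and G :: "'a pair_pre_digraph"
    and g :: "'b \<Rightarrow> 'a" and c :: "'a step list" and y :: 'b and x :: 'a
  assumes g: "digraph_map H G g" and c: "walk G (g y) c x"
begin

lemma walk_transport: "walk H y es y \<Longrightarrow> walk G x (transport g c es) x"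
  unfolding transport_def
  by (rule walk_appendI[OF walk_rev_walk[OF c] walk_appendI[OF walk_map_walk[OF g] c]])

lemma pull_mk_path:
  "walk H y es y \<Longrightarrow> pull H y x g c u (mk_path y es) = u (mk_path x (transport g c es))"
  by (simp add: pull_def mk_path_in_loops steps_of_mk_path)

lemma transport_homotopic:
  "walk_homotopic H y y es ts \<Longrightarrow> walk_homotopic G x x (transport g c es) (transport g c ts)"
  unfolding transport_def
  by (rule walk_homotopic_whisker[OF walk_homotopic_map_walk[OF g] walk_rev_walk[OF c] c])

text \<open>
  The two transported loops meet in \<open>c\<close> followed by its reverse, which cancels up to homotopy but not
  on the nose; therefore pullback respects the comultiplication only on homotopy invariant functions.
\<close>

lemma transport_append:
  assumes "walk H y es y" "walk H y fs y"
  shows "walk_homotopic G x x (transport g c (es @ fs)) (transport g c es @ transport g c fs)"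
  using walk_homotopic_cancel_mid[of G x "rev_walk c @ map_walk g es" "g y" c x "map_walk g fs @ c" x]
    walk_appendI[OF walk_rev_walk[OF c] walk_map_walk[OF g assms(1)]]
    walk_appendI[OF walk_map_walk[OF g assms(2)] c] c
  by (simp add: transport_def map_walk_append walk_homotopic_sym)

lemma transport_Nil: "walk_homotopic G x x (transport g c []) []"
  using walk_homotopic_cancel'[OF c] by (simp add: transport_def map_walk_def)

lemma pull_extensional: "pull H y x g c u \<in> extensional (loops H y)"
  by (simp add: pull_def)

lemma pull_one: "pull H y x g c (\<lambda>\<alpha>\<in>loops G x. 1) = (\<lambda>\<beta>\<in>loops H y. 1)"
  by (rule loop_function_eqI[OF pull_extensional restrict_extensional])
    (simp add: pull_mk_path walk_transport mk_path_in_loops)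

lemma pull_add: "pull H y x g c (\<lambda>\<alpha>\<in>loops G x. u \<alpha> + v \<alpha>) =
    (\<lambda>\<beta>\<in>loops H y. pull H y x g c u \<beta> + pull H y x g c v \<beta>)"
  by (rule loop_function_eqI[OF pull_extensional restrict_extensional])
    (simp add: pull_mk_path walk_transport mk_path_in_loops)

lemma pull_mult: "pull H y x g c (\<lambda>\<alpha>\<in>loops G x. u \<alpha> * v \<alpha>) =
    (\<lambda>\<beta>\<in>loops H y. pull H y x g c u \<beta> * pull H y x g c v \<beta>)"
  by (rule loop_function_eqI[OF pull_extensional restrict_extensional])
    (simp add: pull_mk_path walk_transport mk_path_in_loops)

lemma pull_smult: "pull H y x g c (\<lambda>\<alpha>\<in>loops G x. k * u \<alpha>) =
    (\<lambda>\<beta>\<in>loops H y. k * pull H y x g c u \<beta>)"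
  by (rule loop_function_eqI[OF pull_extensional restrict_extensional])
    (simp add: pull_mk_path walk_transport mk_path_in_loops)

text \<open>
  On an iterated integral, Chen's formula splits off the parts along \<open>c\<close> and its reverse, which are
  constants; what remains are iterated integrals of pulled back forms.
\<close>

lemma pull_Q:
  assumes "u \<in> Q_carrier G x"
  shows "pull H y x g c u \<in> Q_carrier H y"
  using assms
proof (induction rule: Q_carrier.induct)
  case one
  show ?case by (simp only: pull_one Q_carrier.one)
next
  case (gen ws)
  let ?pb = "\<lambda>ws. map (pullback_form H g) ws"
  let ?t = "\<lambda>i j. walk_integral (take i ws) (rev_walk c) *
      walk_integral (drop j (drop i ws)) c"
  let ?q = "\<lambda>i j. \<lambda>\<beta>\<in>loops H y. ?t i j * loop_integral H y (?pb (take j (drop i ws))) \<beta>"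
  have forms: "?pb vs \<in> lists (one_forms H)" for vs
    by (auto simp: one_forms_def pullback_form_def)
  have "pull H y x g c (loop_integral G x ws) =
     (\<lambda>\<beta>\<in>loops H y. \<Sum>i\<in>{..length ws}. (\<lambda>\<beta>\<in>loops H y. \<Sum>j\<in>{..length (drop i ws)}. ?q i j \<beta>) \<beta>)"
  proof (rule loop_function_eqI)
    fix es assume es: "walk H y es y"
    have "walk_integral ws (rev_walk c @ map_walk g es @ c) =
       (\<Sum>i\<le>length ws. \<Sum>j\<le>length (drop i ws).
          ?t i j * walk_integral (?pb (take j (drop i ws))) es)"
      unfolding walk_integral_append walk_integral_map_walk[OF es] sum_distrib_left
      by (intro sum.cong refl) (simp add: mult.assoc mult.left_commute)
    then show "pull H y x g c (loop_integral G x ws) (mk_path y es) =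
        (\<lambda>\<beta>\<in>loops H y. \<Sum>i\<in>{..length ws}. (\<lambda>\<beta>\<in>loops H y. \<Sum>j\<in>{..length (drop i ws)}. ?q i j \<beta>) \<beta>)
          (mk_path y es)"
      using es walk_transport[OF es]
      by (simp add: pull_mk_path loop_integral_walk mk_path_in_loops transport_def)
  qed (simp_all add: pull_def)
  also have "\<dots> \<in> Q_carrier H y"
    by (intro Q_carrier_sum Q_carrier.smult loop_integral_in_Q forms) auto
  finally show ?case .
next
  case (add u v)
  show ?case by (simp only: pull_add Q_carrier.add add.IH)
next
  case (mult u v)
  show ?case by (simp only: pull_mult Q_carrier.mult mult.IH)
next
  case (smult u k)
  show ?case by (simp only: pull_smult Q_carrier.smult smult.IH)
qed

lemma pull_pi1:
  assumes u: "u \<in> pi1_carrier G x"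
  shows "pull H y x g c u \<in> pi1_carrier H y"
  unfolding pi1_carrier_iff
proof (intro conjI allI impI pull_Q pi1_carrierD(1)[OF u])
  fix es ts assume es: "walk H y es y" and ts: "walk H y ts y" and hom: "walk_homotopic H y y es ts"
  show "pull H y x g c u (mk_path y es) = pull H y x g c u (mk_path y ts)"
    unfolding pull_mk_path[OF es] pull_mk_path[OF ts]
    by (rule pi1_carrierD(2)[OF u walk_transport[OF es] walk_transport[OF ts] transport_homotopic[OF hom]])
qed

end

text \<open>
  The comultiplication described by values, as for the larger algebra, but with both tensor factors
  homotopy invariant.
\<close>

lemma pi1_comult_iff:
  assumes u: "u \<in> pi1_carrier G x"
  shows "t \<in> comult (pi1_hopf G x) u \<longleftrightarrow>
    Poly_Mapping.keys t \<subseteq> pi1_carrier G x \<times> pi1_carrier G x \<and>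
    (\<forall>es fs. walk G x es x \<longrightarrow> walk G x fs x \<longrightarrow>
       pairing t (mk_path x es) (mk_path x fs) = u (mk_path x (es @ fs)))"
proof -
  have "Poly_Mapping.keys t \<subseteq> Q_carrier G x \<times> Q_carrier G x"
    if "Poly_Mapping.keys t \<subseteq> pi1_carrier G x \<times> pi1_carrier G x"
    by (rule order.trans[OF that]) (intro Sigma_mono subsetI pi1_carrierD(1))
  then show ?thesis
    unfolding pi1_hopf_sel Q_comult_eq[OF pi1_carrierD(1)[OF u]] by blast
qed

section \<open>Homotopy invariance\<close>

text \<open>
  Pullback along \<open>transport g c\<close> is an isomorphism once this operation is bijective on homotopy classes
  of loops: \<open>surjective\<close> makes the pullback injective, and a homotopy left inverse of the same form
  provides preimages, because pullback along that inverse again preserves homotopy invariant iterated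
  integrals. Compatibility with the comultiplication and the antipode holds because these are dual to
  concatenation and reversal, which transport respects.
\<close>

lemma (in based_map) pull_hopf_iso:
  fixes f :: "'a \<Rightarrow> 'b"
  assumes f: "based_map G H f d x y"
    and left_inverse: "\<And>es. walk H y es y \<Longrightarrow>
      walk_homotopic H y y (transport f d (transport g c es)) es"
    and surjective: "\<And>es. walk G x es x \<Longrightarrow>
      \<exists>ts. walk H y ts y \<and> walk_homotopic G x x (transport g c ts) es"
  shows "pull H y x g c \<in> hopf_iso (pi1_hopf G x :: ('k::field_char_0, 'a path_map \<Rightarrow> 'k) hopf_algebra)
    (pi1_hopf H y)"
proof -
  let ?\<phi> = "pull H y x g c :: ('a path_map \<Rightarrow> 'k) \<Rightarrow> ('b path_map \<Rightarrow> 'k)"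
  let ?A = "pi1_carrier G x :: ('a path_map \<Rightarrow> 'k) set"
  let ?B = "pi1_carrier H y :: ('b path_map \<Rightarrow> 'k) set"
  interpret f: based_map G H f d x y by (rule f)
  have ext: "u \<in> extensional (loops G x)" if "u \<in> ?A" for u
    by (rule Q_carrier_extensional[OF pi1_carrierD(1)[OF that]])
  have extB: "u \<in> extensional (loops H y)" if "u \<in> ?B" for u
    by (rule Q_carrier_extensional[OF pi1_carrierD(1)[OF that]])
  have maps: "?\<phi> ` ?A \<subseteq> ?B" by (auto intro: pull_pi1)
  have inj: "inj_on ?\<phi> ?A"
  proof (rule inj_onI)
    fix u v assume u: "u \<in> ?A" and v: "v \<in> ?A" and eq: "?\<phi> u = ?\<phi> v"
    show "u = v"
    proof (rule loop_function_eqI[OF ext[OF u] ext[OF v]])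
      fix es assume es: "walk G x es x"
      obtain ts where ts: "walk H y ts y" and hom: "walk_homotopic G x x (transport g c ts) es"
        using surjective[OF es] by (elim exE conjE)
      have "w (mk_path x es) = ?\<phi> w (mk_path y ts)" if "w \<in> ?A" for w
        unfolding pull_mk_path[OF ts]
        by (rule pi1_carrierD(2)[OF that walk_transport[OF ts] es hom, symmetric])
      from this[OF u] this[OF v] show "u (mk_path x es) = v (mk_path x es)" using eq by simp
    qed
  qed
  have right_inverse: "?\<phi> (pull G x y f d w) = w" if w: "w \<in> ?B" for w
  proof (rule loop_function_eqI[OF pull_extensional extB[OF w]])
    fix es assume es: "walk H y es y"
    show "?\<phi> (pull G x y f d w) (mk_path y es) = w (mk_path y es)"
      unfolding pull_mk_path[OF es] f.pull_mk_path[OF walk_transport[OF es]]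
      by (rule pi1_carrierD(2)[OF w f.walk_transport[OF walk_transport[OF es]] es left_inverse[OF es]])
  qed
  have bij: "bij_betw ?\<phi> ?A ?B"
    unfolding bij_betw_def
  proof (intro conjI inj subset_antisym maps subsetI)
    fix w assume w: "w \<in> ?B"
    show "w \<in> ?\<phi> ` ?A"
      by (rule image_eqI[where f = ?\<phi>, OF right_inverse[OF w, symmetric] f.pull_pi1[OF w]])
  qed
  have ring: "?\<phi> \<in> ring_iso (pi1_hopf G x) (pi1_hopf H y)"
    using pull_pi1 bij by (intro ring_iso_memI) (simp_all only: pi1_hopf_sel pull_mult pull_add pull_one)
  have base: "walk H y [] y"
    using f.c walk_end by (metis walk.simps(1))
  have counit: "Q_counit y (?\<phi> u) = Q_counit x u" if u: "u \<in> ?A" for u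
    unfolding Q_counit_def const_loop_eq pull_mk_path[OF base]
    by (rule pi1_carrierD(2)[OF u walk_transport[OF base] _ transport_Nil])
      (use c in \<open>auto dest: walk_end\<close>)
  have antipode: "Q_antipode H y (?\<phi> u) = ?\<phi> (Q_antipode G x u)" if u: "u \<in> ?A" for u
  proof (rule loop_function_eqI)
    note uQ = pi1_carrierD(1)[OF u]
    show "Q_antipode H y (?\<phi> u) \<in> extensional (loops H y)"
      by (rule Q_antipode_walk(1)[OF pull_Q[OF uQ]])
    show "?\<phi> (Q_antipode G x u) \<in> extensional (loops H y)" by (rule pull_extensional)
    fix es assume es: "walk H y es y"
    show "Q_antipode H y (?\<phi> u) (mk_path y es) = ?\<phi> (Q_antipode G x u) (mk_path y es)"
      by (simp add: Q_antipode_walk(2)[OF pull_Q[OF uQ] es] pull_mk_path[OF es]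
          pull_mk_path[OF walk_rev_walk[OF es]] Q_antipode_walk(2)[OF uQ walk_transport[OF es]]
          transport_rev_walk)
  qed
  have push_pairing: "pairing (push ?\<phi> t) (mk_path y es) (mk_path y fs) =
      pairing t (mk_path x (transport g c es)) (mk_path x (transport g c fs))"
    if "walk H y es y" "walk H y fs y" for t es fs
    unfolding pairing_push pull_mk_path[OF that(1)] pull_mk_path[OF that(2)]
    unfolding pairing_def ..
  have coproduct: "?\<phi> u (mk_path y (es @ fs)) =
      u (mk_path x (transport g c es @ transport g c fs))"
    if u: "u \<in> ?A" and es: "walk H y es y" and fs: "walk H y fs y" for u es fs
    unfolding pull_mk_path[OF walk_appendI[OF es fs]]
    by (rule pi1_carrierD(2)[OF u walk_transport[OF walk_appendI[OF es fs]]
          walk_appendI[OF walk_transport[OF es] walk_transport[OF fs]] transport_append[OF es fs]])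
  interpret B: function_space "pi1_hopf H y :: ('k, 'b path_map \<Rightarrow> 'k) hopf_algebra" "loops H y"
    by (rule function_space_pi1)
  have comult: "comult (pi1_hopf H y) (?\<phi> u) = tensor_map (pi1_hopf H y) ?\<phi> (comult (pi1_hopf G x) u)"
    if u: "u \<in> ?A" for u
  proof (rule Set.set_eqI)
    fix s :: "(('b path_map \<Rightarrow> 'k) \<times> ('b path_map \<Rightarrow> 'k)) \<Rightarrow>\<^sub>0 'k"
    have tensor_map: "s \<in> tensor_map (pi1_hopf H y) ?\<phi> (comult (pi1_hopf G x) u) \<longleftrightarrow>
        (\<exists>t\<in>comult (pi1_hopf G x) u.
          Poly_Mapping.keys s \<subseteq> ?B \<times> ?B \<and> s - push ?\<phi> t \<in> tensor_null (pi1_hopf H y))"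
      by (auto simp: tensor_map_def tensor_class_def push_def pi1_hopf_sel(1))
    have null: "s - push ?\<phi> t \<in> tensor_null (pi1_hopf H y) \<longleftrightarrow>
        (\<forall>es fs. walk H y es y \<longrightarrow> walk H y fs y \<longrightarrow>
          pairing s (mk_path y es) (mk_path y fs) =
          pairing t (mk_path x (transport g c es)) (mk_path x (transport g c fs)))"
      if "Poly_Mapping.keys s \<subseteq> ?B \<times> ?B" "Poly_Mapping.keys t \<subseteq> ?A \<times> ?A" for t
    proof -
      have "Poly_Mapping.keys (s - push ?\<phi> t) \<subseteq> ?B \<times> ?B"
        using keys_diff[of s "push ?\<phi> t"] keys_push[OF maps that(2)] that(1) by blast
      then have "s - push ?\<phi> t \<in> tensor_null (pi1_hopf H y) \<longleftrightarrow>
        (\<forall>es. walk H y es y \<longrightarrow> (\<forall>fs. walk H y fs y \<longrightarrow>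
          pairing (s - push ?\<phi> t) (mk_path y es) (mk_path y fs) = 0))"
        using B.null_iff_pairing[of "s - push ?\<phi> t"] unfolding pi1_hopf_sel(1) ball_loops by simp
      moreover have "pairing (s - push ?\<phi> t) a b = pairing s a b - pairing (push ?\<phi> t) a b" for a b
        by (simp add: pairing_def linear_ext_diff)
      ultimately show ?thesis by (simp add: push_pairing)
    qed
    show "s \<in> comult (pi1_hopf H y) (?\<phi> u) \<longleftrightarrow>
        s \<in> tensor_map (pi1_hopf H y) ?\<phi> (comult (pi1_hopf G x) u)"
    proof
      assume "s \<in> comult (pi1_hopf H y) (?\<phi> u)"
      then have s: "Poly_Mapping.keys s \<subseteq> ?B \<times> ?B"
        and ps: "\<And>es fs. walk H y es y \<Longrightarrow> walk H y fs y \<Longrightarrow>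
          pairing s (mk_path y es) (mk_path y fs) = ?\<phi> u (mk_path y (es @ fs))"
        unfolding pi1_comult_iff[OF pull_pi1[OF u]] by blast+
      \<comment> \<open>A tensor of functions on loops of \<open>H\<close> is lifted through the inverse of the pullback. Its function is
          known on transported loops only; these meet every homotopy class, and the factors of \<open>t\<close> are
          homotopy invariant.\<close>
      define t where "t = push (pull G x y f d) s"
      have t: "Poly_Mapping.keys t \<subseteq> ?A \<times> ?A"
        unfolding t_def by (rule keys_push[OF _ s]) (auto intro: f.pull_pi1)
      have eq: "pairing s (mk_path y es) (mk_path y fs) =
          pairing t (mk_path x (transport g c es)) (mk_path x (transport g c fs))"
        if es: "walk H y es y" and fs: "walk H y fs y" for es fs
      proof -
        have "pull G x y f d w (mk_path x (transport g c es)) = w (mk_path y es)"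
          if "w \<in> ?B" "walk H y es y" for w es
          using right_inverse[OF that(1)] pull_mk_path[OF that(2), of "pull G x y f d w"] by simp
        then show ?thesis
          unfolding t_def pairing_push unfolding pairing_def using s es fs
          by (intro linear_ext_cong) auto
      qed
      have "t \<in> comult (pi1_hopf G x) u"
        unfolding pi1_comult_iff[OF u]
      proof (intro conjI t allI impI)
        fix es fs assume es: "walk G x es x" and fs: "walk G x fs x"
        obtain es' where es': "walk H y es' y" "walk_homotopic G x x (transport g c es') es"
          using surjective[OF es] by (elim exE conjE)
        obtain fs' where fs': "walk H y fs' y" "walk_homotopic G x x (transport g c fs') fs"
          using surjective[OF fs] by (elim exE conjE)
        note walks = walk_transport[OF es'(1)] walk_transport[OF fs'(1)]
        have "pairing t (mk_path x es) (mk_path x fs) =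
            pairing t (mk_path x (transport g c es')) (mk_path x (transport g c fs'))"
          by (rule pairing_cong[OF t])
            (erule pi1_carrierD(2)[OF _ es walks(1) walk_homotopic_sym[OF es'(2)]],
             erule pi1_carrierD(2)[OF _ fs walks(2) walk_homotopic_sym[OF fs'(2)]])
        also have "\<dots> = u (mk_path x (transport g c es' @ transport g c fs'))"
          using eq[OF es'(1) fs'(1)] ps[OF es'(1) fs'(1)] coproduct[OF u es'(1) fs'(1)] by simp
        also have "\<dots> = u (mk_path x (es @ fs))"
          by (rule pi1_carrierD(2)[OF u walk_appendI[OF walks] walk_appendI[OF es fs]
                walk_homotopic_append[OF es'(2) fs'(2) es walks(2)]])
        finally show "pairing t (mk_path x es) (mk_path x fs) = u (mk_path x (es @ fs))" .
      qed
      moreover have "s - push ?\<phi> t \<in> tensor_null (pi1_hopf H y)"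
        unfolding null[OF s t] using eq by blast
      ultimately show "s \<in> tensor_map (pi1_hopf H y) ?\<phi> (comult (pi1_hopf G x) u)"
        unfolding tensor_map using s by blast
    next
      assume "s \<in> tensor_map (pi1_hopf H y) ?\<phi> (comult (pi1_hopf G x) u)"
      then obtain t where t: "t \<in> comult (pi1_hopf G x) u" and s: "Poly_Mapping.keys s \<subseteq> ?B \<times> ?B"
        and st: "s - push ?\<phi> t \<in> tensor_null (pi1_hopf H y)"
        unfolding tensor_map by (elim bexE conjE)
      from t have tA: "Poly_Mapping.keys t \<subseteq> ?A \<times> ?A"
        and pt: "\<And>es fs. walk G x es x \<Longrightarrow> walk G x fs x \<Longrightarrow>
          pairing t (mk_path x es) (mk_path x fs) = u (mk_path x (es @ fs))"
        unfolding pi1_comult_iff[OF u] by blast+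
      show "s \<in> comult (pi1_hopf H y) (?\<phi> u)"
        unfolding pi1_comult_iff[OF pull_pi1[OF u]]
      proof (intro conjI s allI impI)
        fix es fs assume es: "walk H y es y" and fs: "walk H y fs y"
        have "pairing s (mk_path y es) (mk_path y fs) =
            pairing t (mk_path x (transport g c es)) (mk_path x (transport g c fs))"
          using st es fs unfolding null[OF s tA] by simp
        also have "\<dots> = ?\<phi> u (mk_path y (es @ fs))"
          unfolding coproduct[OF u es fs] by (rule pt[OF walk_transport[OF es] walk_transport[OF fs]])
        finally show "pairing s (mk_path y es) (mk_path y fs) = ?\<phi> u (mk_path y (es @ fs))" .
      qed
    qed
  qed
  show ?thesis
    unfolding hopf_iso_def
  proof (intro CollectI conjI ring ballI allI)
    fix k u assume u: "u \<in> carrier (pi1_hopf G x :: ('k, 'a path_map \<Rightarrow> 'k) hopf_algebra)"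
    note u = u[unfolded pi1_hopf_sel(1)]
    show "?\<phi> (k \<odot>\<^bsub>pi1_hopf G x\<^esub> u) = k \<odot>\<^bsub>pi1_hopf H y\<^esub> ?\<phi> u"
      unfolding pi1_hopf_sel by (rule pull_smult)
  next
    fix u assume u: "u \<in> carrier (pi1_hopf G x :: ('k, 'a path_map \<Rightarrow> 'k) hopf_algebra)"
    note u = u[unfolded pi1_hopf_sel(1)]
    show "counit (pi1_hopf H y) (?\<phi> u) = counit (pi1_hopf G x) u"
      unfolding pi1_hopf_sel by (rule counit[OF u])
    show "comult (pi1_hopf H y) (?\<phi> u) = tensor_map (pi1_hopf H y) ?\<phi> (comult (pi1_hopf G x) u)"
      by (rule comult[OF u])
    show "antipode (pi1_hopf H y) (?\<phi> u) = ?\<phi> (antipode (pi1_hopf G x) u)"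
      unfolding pi1_hopf_sel by (rule antipode[OF u])
  qed
qed

theorem theorem5p11:
  fixes G :: "'a pair_pre_digraph" and H :: "'b pair_pre_digraph" and x :: 'a and y :: 'b
  assumes "pair_digraph G" and "pair_digraph H"
    and "connected_digraph G" and "connected_digraph H"
    and "x \<in> pverts G" and "y \<in> pverts H"
    and "homotopy_equivalent G H"
  shows "hopf_isomorphic
    (pi1_hopf G x :: ('k::field_char_0, 'a path_map \<Rightarrow> 'k) hopf_algebra)
    (pi1_hopf H y :: ('k, 'b path_map \<Rightarrow> 'k) hopf_algebra)"
proof -
  from \<open>homotopy_equivalent G H\<close> obtain f g
    where f: "digraph_map G H f" and g: "digraph_map H G g"
      and fg: "homotopic_maps H H (f \<circ> g) id" and gf: "homotopic_maps G G (g \<circ> f) id"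
    unfolding homotopy_equivalent_def by blast
  obtain p where p: "walk H (f (g y)) p y"
    and p_hom: "\<And>es. walk H y es y \<Longrightarrow> walk_homotopic H (f (g y)) (f (g y))
      (map_walk (f \<circ> g) es) (p @ es @ rev_walk p)"
    using homotopic_maps_track[OF fg \<open>y \<in> pverts H\<close>] by (metis comp_apply id_apply map_walk_id)
  obtain q where q: "walk G (g (f x)) q x"
    and q_hom: "\<And>es. walk G x es x \<Longrightarrow> walk_homotopic G (g (f x)) (g (f x))
      (map_walk (g \<circ> f) es) (q @ es @ rev_walk q)"
    using homotopic_maps_track[OF gf \<open>x \<in> pverts G\<close>] by (metis comp_apply id_apply map_walk_id)
  have "g y \<in> pverts G" by (rule digraph_map_vertex[OF g \<open>y \<in> pverts H\<close>])
  then obtain \<gamma> where \<gamma>: "path_map G \<gamma>" "pstart \<gamma> = g y" "pend \<gamma> = x"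
    using \<open>connected_digraph G\<close> \<open>x \<in> pverts G\<close> unfolding connected_digraph_def by blast
  define c where "c = steps_of \<gamma>"
  have c: "walk G (g y) c x"
    using walk_steps_of[OF \<gamma>(1)] by (simp add: c_def \<gamma>(2,3))
  \<comment> \<open>The walk \<open>d\<close> is chosen so that the composite of the two transports conjugates \<open>f \<circ> g\<close> by \<open>p\<close>
      itself, which the track of the homotopy turns into the identity.\<close>
  define d where "d = rev_walk (map_walk f c) @ p"
  note fc = walk_map_walk[OF f c]
  have d: "walk H (f x) d y"
    unfolding d_def by (rule walk_appendI[OF walk_rev_walk[OF fc] p])
  interpret G: based_map H G g c y x using g c by unfold_locales
  interpret H: based_map G H f d x y using f d by unfold_locales
  have left_inverse: "walk_homotopic H y y (transport f d (transport g c es)) es"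
    if es: "walk H y es y" for es
  proof -
    let ?m = "map_walk (f \<circ> g) es" and ?fc = "map_walk f c"
    have m: "walk H (f (g y)) ?m (f (g y))"
      using walk_map_walk[OF f walk_map_walk[OF g es]] by (simp add: map_walk_comp)
    note p' = walk_rev_walk[OF p]
    have "transport f d (transport g c es) =
        rev_walk p @ ?fc @ rev_walk ?fc @ ?m @ ?fc @ rev_walk ?fc @ p"
      by (simp add: transport_def d_def map_walk_append rev_walk_append map_walk_rev_walk map_walk_comp)
    also have "walk_homotopic H y y \<dots> (rev_walk p @ ?m @ ?fc @ rev_walk ?fc @ p)"
      by (rule walk_homotopic_cancel_mid[OF p' fc
            walk_appendI[OF m walk_appendI[OF fc walk_appendI[OF walk_rev_walk[OF fc] p]]]])
    also have "walk_homotopic H y y \<dots> (rev_walk p @ ?m @ p)"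
      using walk_homotopic_cancel_mid[OF walk_appendI[OF p' m] fc p] by simp
    also have "walk_homotopic H y y \<dots> (rev_walk p @ (p @ es @ rev_walk p) @ p)"
      by (rule walk_homotopic_whisker[OF p_hom[OF es] p' p])
    also have "walk_homotopic H y y \<dots> es"
      using walk_homotopic_conj_loop[OF p es] by simp
    finally show ?thesis .
  qed
  have surjective: "\<exists>ts. walk H y ts y \<and> walk_homotopic G x x (transport g c ts) es"
    if es: "walk G x es x" for es
  proof -
    \<comment> \<open>The other composite is conjugation by the loop \<open>l\<close>, so conjugating the given loop back first
        makes it hit \<open>es\<close>.\<close>
    define k where "k = map_walk g d @ c"
    have k: "walk G (g (f x)) k x"
      unfolding k_def by (rule walk_appendI[OF walk_map_walk[OF g d] c])
    define l where "l = rev_walk q @ k"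
    have l: "walk G x l x" unfolding l_def by (rule walk_appendI[OF walk_rev_walk[OF q] k])
    define es' where "es' = l @ es @ rev_walk l"
    have es': "walk G x es' x"
      unfolding es'_def by (rule walk_appendI[OF l walk_appendI[OF es walk_rev_walk[OF l]]])
    have "transport g c (transport f d es') = rev_walk k @ map_walk (g \<circ> f) es' @ k"
      by (simp add: transport_def k_def map_walk_append rev_walk_append map_walk_rev_walk map_walk_comp)
    also have "walk_homotopic G x x \<dots> (rev_walk k @ (q @ es' @ rev_walk q) @ k)"
      by (rule walk_homotopic_whisker[OF q_hom[OF es'] walk_rev_walk[OF k] k])
    also have "walk_homotopic G x x \<dots> es"
      using walk_homotopic_conj_loop[OF l es] by (simp add: es'_def l_def rev_walk_append)
    finally show ?thesis using H.walk_transport[OF es'] by blast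
  qed
  have "pull H y x g c \<in> hopf_iso (pi1_hopf G x :: ('k, 'a path_map \<Rightarrow> 'k) hopf_algebra) (pi1_hopf H y)"
    by (rule G.pull_hopf_iso[OF H.based_map_axioms left_inverse surjective])
  then show ?thesis unfolding hopf_isomorphic_def by blast
qed

end
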